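(* Every connected subcubic graph $G$ (i.e. $\Delta(G)\le 3$) other than the $5$-cycle $C_5$ is proper conflict-free $\kappa_G$-choosable.
   Context: All graphs are finite, simple and undirected, with nonempty vertex set. The function $\kappa_G:V(G)\to\mathbb{N}$ is defined by $\kappa_G(v)=4$ if $d_G(v)=2$ and $\kappa_G(v)=d_G(v)+1$ if $d_G(v)\neq 2$. A list assignment $L$ assigns to each vertex $v$ a set $L(v)$ of colors; an $L$-coloring is a map $\varphi$ on $V(G)$ with $\varphi(v)\in L(v)$ for every $v$ and $\varphi(u)\neq\varphi(v)$ for every edge $uv$. A (proper) $L$-coloring is proper conflict-free if for every non-isolated vertex $v$ there is a color that appears exactly once in the neighborhood $N_G(v)$ (i.e. on exactly one neighbor of $v$). $G$ is proper conflict-free $\kappa_G$-choosable if every list assignment $L$ with $|L(v)|\ge\kappa_G(v)$ for all $v\in V(G)$ admits a proper conflict-free $L$-coloring of $G$. *)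

theory Defs
  imports "Graph_Theory.Graph_Theory"
begin

text \<open>
  Finite simple graphs are rendered by the locale \<open>pair_graph\<close>: an undirected edge \<open>uv\<close> is the
  pair of arcs \<open>(u, v)\<close> and \<open>(v, u)\<close>. A graph that is \<open>Digraph_Component.connected\<close> has at least
  one vertex.
\<close>

definition neighborhood :: "'a pair_pre_digraph \<Rightarrow> 'a \<Rightarrow> 'a set" where
  "neighborhood G v = {u. (v, u) \<in> parcs G}"

definition vdegree :: "'a pair_pre_digraph \<Rightarrow> 'a \<Rightarrow> nat" where
  "vdegree G v = card (neighborhood G v)"

lemma vdegree_eq_out_degree: "vdegree G v = out_degree (with_proj G) v"
proof -
  have "out_arcs (with_proj G) v = Pair v ` neighborhood G v"
    by (auto simp: out_arcs_def neighborhood_def)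
  then show ?thesis
    by (simp add: vdegree_def out_degree_def card_image inj_on_def)
qed

text \<open>Meaningful when the vertex set is finite and nonempty.\<close>
definition max_degree :: "'a pair_pre_digraph \<Rightarrow> nat" where
  "max_degree G = Max (vdegree G ` pverts G)"

definition subcubic :: "'a pair_pre_digraph \<Rightarrow> bool" where
  "subcubic G \<longleftrightarrow> max_degree G \<le> 3"

definition kappa :: "'a pair_pre_digraph \<Rightarrow> 'a \<Rightarrow> nat" where
  "kappa G v = (if vdegree G v = 2 then 4 else vdegree G v + 1)"

definition list_coloring :: "'a pair_pre_digraph \<Rightarrow> ('a \<Rightarrow> 'c set) \<Rightarrow> ('a \<Rightarrow> 'c) \<Rightarrow> bool" where
  "list_coloring G L \<phi> \<longleftrightarrow>
     (\<forall>v\<in>pverts G. \<phi> v \<in> L v) \<and> (\<forall>(u, v)\<in>parcs G. \<phi> u \<noteq> \<phi> v)"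

definition conflict_free :: "'a pair_pre_digraph \<Rightarrow> ('a \<Rightarrow> 'c) \<Rightarrow> bool" where
  "conflict_free G \<phi> \<longleftrightarrow>
     (\<forall>v\<in>pverts G. neighborhood G v \<noteq> {} \<longrightarrow> (\<exists>c. \<exists>!u. u \<in> neighborhood G v \<and> \<phi> u = c))"

text \<open>
  The type of colors is a parameter. Since \<open>card\<close> of an infinite set is \<open>0\<close>, the size condition
  on the lists is stated so that infinite lists are also allowed.
\<close>
definition pcf_choosable :: "'c itself \<Rightarrow> 'a pair_pre_digraph \<Rightarrow> ('a \<Rightarrow> nat) \<Rightarrow> bool" where
  "pcf_choosable _ G f \<longleftrightarrow>
     (\<forall>L :: 'a \<Rightarrow> 'c set.
        (\<forall>v\<in>pverts G. infinite (L v) \<or> f v \<le> card (L v)) \<longrightarrow>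
        (\<exists>\<phi>. list_coloring G L \<phi> \<and> conflict_free G \<phi>))"

text \<open>The cycle with \<open>n\<close> vertices, for \<open>n \<ge> 3\<close>.\<close>
definition cycle_graph :: "nat \<Rightarrow> nat pair_pre_digraph" where
  "cycle_graph n =
     \<lparr> pverts = {0..<n},
       parcs = {(i, j). i < n \<and> j < n \<and> (j = Suc i mod n \<or> i = Suc j mod n)} \<rparr>"

end

theory Submission
  imports Defs
begin

text \<open>
  Since all degrees are at most 3, a proper colouring is conflict-free iff no vertex with at least
  two neighbours has all its neighbours of one colour. Read this way, the condition at a vertex
  survives when further neighbours are added. Hence, if a colouring of \<open>G - D\<close> is given, a
  vertex of degree 3 that loses exactly one neighbour to \<open>D\<close> has two neighbours left in
  \<open>G - D\<close>, of different colours, and imposes nothing on the colours of \<open>D\<close>. The list sizes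
  \<open>\<kappa>\<close> are monotone in the degree, so the lists are long enough in \<open>G - D\<close> as well. Thus a
  minimal counterexample \<open>S\<close> (among vertex sets inducing subgraphs without a component
  \<open>C\<^sub>5\<close>) can be attacked by deleting small sets \<open>D\<close> (\<open>good_extend\<close>):

  \<^item> A path of four vertices of degree 2 is reducible if the vertex following each of its
    ends has just one neighbour outside the path (\<open>path4_reducible\<close>): the constraints among the
    four form the graph \<open>K\<^sub>4\<close> minus an edge, which is colourable from lists of sizes 2, 3, 3, 2
    (\<open>diamond_colouring\<close>). This disposes of the long cycles, and of 5-cycles attached to the rest
    of the graph at a single vertex.
  \<^item> A vertex of degree at most 1, deleted together with its neighbour if that has degree 2, is
    reducible (\<open>minimal_degree_ge_2\<close>).
  \<^item> Two adjacent vertices of degree 2 are reducible (\<open>deg2_pair_reducible\<close>, \<open>deg2_independent\<close>).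
  \<^item> A vertex of degree 3, deleted together with its neighbours of degree 2, is reducible if there
    are such neighbours (\<open>star_many_reducible\<close>, \<open>star_one_reducible\<close>).
  \<^item> Otherwise the graph is cubic, and two adjacent vertices are deleted (\<open>cubic_reducible\<close>).

  The deletion may leave a component \<open>C\<^sub>5\<close>, to which the induction hypothesis does not apply.
  Such a 5-cycle has at least two vertices with neighbours in \<open>D\<close> (\<open>pentagon_two_exits\<close>), so in
  each case there is at most one. It is coloured so that the conflict-free condition fails only at
  one chosen vertex \<open>c\<close> with a neighbour in \<open>D\<close> (\<open>pentagon_colouring\<close>); the condition at \<open>c\<close> is
  then restored by the colour of that neighbour.
\<close>

section \<open>Large lists\<close>

definition large :: "nat \<Rightarrow> 'c set \<Rightarrow> bool" where
  "large k A \<longleftrightarrow> infinite A \<or> k \<le> card A"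

lemma large_pick:
  assumes "large k A" "finite X" "card X < k"
  shows "\<exists>x\<in>A. x \<notin> X"
proof (rule ccontr)
  assume "\<not> ?thesis"
  then have "A \<subseteq> X" by blast
  then have "finite A" "card A \<le> card X"
    using assms(2) by (auto intro: finite_subset card_mono)
  then show False using assms by (auto simp: large_def)
qed

lemma large_mono: "large k A \<Longrightarrow> j \<le> k \<Longrightarrow> large j A"
  by (auto simp: large_def)

lemma large_remove: "large (Suc k) A \<Longrightarrow> large k (A - {x})"
  unfolding large_def by (cases "finite A") (auto simp: card_Diff_singleton_if)

lemma large_remove1: "large 4 A \<Longrightarrow> large 3 (A - {x})"
  using large_remove[of 3 A x] by simp

lemma large_remove2: "large 4 A \<Longrightarrow> large 2 (A - {x, y})"
  using large_remove[OF large_remove, of 2 A x y] by (simp add: Diff_insert2[symmetric] insert_commute numeral_eq_Suc)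

lemma large_pick1: "large 2 A \<Longrightarrow> \<exists>x\<in>A. x \<noteq> p"
  using large_pick[of 2 A "{p}"] by auto

lemma large_pick3: "large 4 A \<Longrightarrow> \<exists>x\<in>A. x \<noteq> p \<and> x \<noteq> q \<and> x \<noteq> r"
  using large_pick[of 4 A "{p, q, r}"] by (auto simp: card_insert_if)

text \<open>
  The graph is \<open>K\<^sub>4\<close> without the edge \<open>x1 x4\<close>. If \<open>x1\<close> and \<open>x4\<close> can get the same colour, or one
  of them a colour missing from \<open>A2\<close>, then \<open>x2\<close> loses at most two colours to its three neighbours
  and is coloured last. Otherwise \<open>A1\<close> and \<open>A4\<close> are disjoint subsets of \<open>A2\<close>, so \<open>A2\<close> has at
  least four colours, and again \<open>x2\<close> is coloured last.
\<close>
lemma diamond_colouring: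
  assumes "large 2 A1" "large 3 A2" "large 3 A3" "large 2 A4"
  obtains x1 x2 x3 x4 where "x1 \<in> A1" "x2 \<in> A2" "x3 \<in> A3" "x4 \<in> A4"
    "x1 \<noteq> x2" "x1 \<noteq> x3" "x2 \<noteq> x3" "x2 \<noteq> x4" "x3 \<noteq> x4"
proof -
  note choose = that
  have two: "\<exists>x\<in>A. x \<notin> {p, q}" if "large 3 A" for A :: "'a set" and p q
    using large_pick[OF that, of "{p, q}"] by (auto simp: card_insert_if)
  have colour: thesis
    if x: "x1 \<in> A1" "x4 \<in> A4" "x1 = x4 \<or> x1 \<notin> A2 \<or> x4 \<notin> A2" for x1 x4
  proof -
    obtain x3 where x3: "x3 \<in> A3" "x3 \<notin> {x1, x4}" using two[OF assms(3)] by blast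
    have "\<exists>x2\<in>A2. x2 \<notin> {x1, x4, x3}"
      using x(3) two[OF assms(2), of x1 x3] two[OF assms(2), of x4 x3] by auto
    then obtain x2 where "x2 \<in> A2" "x2 \<notin> {x1, x4, x3}" by blast
    then show thesis using x3 x(1,2) by (intro choose[of x1 x2 x3 x4]) auto
  qed
  obtain a1 a4 where a: "a1 \<in> A1" "a4 \<in> A4"
    using large_pick1[OF assms(1)] large_pick1[OF assms(4)] by blast
  show thesis
  proof (cases "A1 \<inter> A4 = {}")
    case False
    then show thesis using colour by blast
  next
    case True
    have "\<not> A1 \<union> A4 \<subseteq> A2" if "finite A2" "card A2 = 3"
    proof
      assume *: "A1 \<union> A4 \<subseteq> A2"
      then have fin: "finite A1" "finite A4" using that finite_subset by auto
      then have "card A1 + card A4 \<le> 3"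
        using True * that card_mono[of A2 "A1 \<union> A4"] by (simp add: card_Un_disjoint)
      then show False using fin assms(1,4) by (auto simp: large_def)
    qed
    moreover have ?thesis if "\<not> A1 \<union> A4 \<subseteq> A2"
      using that a colour by blast
    moreover have thesis if big: "large 4 A2"
    proof -
      obtain x3 where x3: "x3 \<in> A3" "x3 \<notin> {a1, a4}" using two[OF assms(3)] by blast
      obtain x2 where "x2 \<in> A2" "x2 \<noteq> a1" "x2 \<noteq> a4" "x2 \<noteq> x3"
        using large_pick3[OF big] by blast
      then show thesis using x3 a by (intro choose[of a1 x2 x3 a4]) auto
    qed
    ultimately show thesis using assms(2) unfolding large_def by force
  qed
qed

section \<open>Partial colourings of induced subgraphs\<close>

definition list_size :: "nat \<Rightarrow> nat" where
  "list_size d = (if d = 2 then 4 else d + 1)"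

lemma list_size_mono: "d \<le> e \<Longrightarrow> list_size d \<le> list_size e"
  by (auto simp: list_size_def)

text \<open>
  The graph \<open>E\<close> and the lists \<open>L\<close> are fixed; the induction ranges over vertex sets \<open>S\<close>, which stand
  for the subgraphs that they induce.
\<close>
locale list_assignment =
  fixes E :: "'a \<Rightarrow> 'a \<Rightarrow> bool" and L :: "'a \<Rightarrow> 'c set"
  assumes sym: "E u v \<Longrightarrow> E v u" and irrefl: "\<not> E v v"
begin

definition nb :: "'a set \<Rightarrow> 'a \<Rightarrow> 'a set" where
  "nb S v = {u \<in> S. E v u}"

text \<open>For a vertex of degree at most 3 this is the conflict-free condition.\<close>
definition diverse :: "'a set \<Rightarrow> ('a \<Rightarrow> 'c) \<Rightarrow> 'a \<Rightarrow> bool" where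
  "diverse S \<phi> v \<longleftrightarrow> (2 \<le> card (nb S v) \<longrightarrow> (\<exists>x\<in>nb S v. \<exists>y\<in>nb S v. \<phi> x \<noteq> \<phi> y))"

text \<open>The set \<open>F\<close> collects the vertices at which the conflict-free condition may fail.\<close>
definition good :: "'a set \<Rightarrow> 'a set \<Rightarrow> ('a \<Rightarrow> 'c) \<Rightarrow> bool" where
  "good S F \<phi> \<longleftrightarrow> (\<forall>v\<in>S. \<phi> v \<in> L v) \<and> (\<forall>v\<in>S. \<forall>x\<in>nb S v. \<phi> v \<noteq> \<phi> x) \<and>
     (\<forall>v\<in>S - F. diverse S \<phi> v)"

text \<open>
  The neighbourhoods are taken in \<open>S\<close> and given exactly, so this describes a component \<open>C\<^sub>5\<close> of
  the subgraph induced by \<open>S\<close>.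
\<close>
definition pentagon :: "'a set \<Rightarrow> 'a \<Rightarrow> 'a \<Rightarrow> 'a \<Rightarrow> 'a \<Rightarrow> 'a \<Rightarrow> bool" where
  "pentagon S c0 c1 c2 c3 c4 \<longleftrightarrow> distinct [c0, c1, c2, c3, c4] \<and>
     nb S c0 = {c4, c1} \<and> nb S c1 = {c0, c2} \<and> nb S c2 = {c1, c3} \<and>
     nb S c3 = {c2, c4} \<and> nb S c4 = {c3, c0}"

definition pentagon_free :: "'a set \<Rightarrow> bool" where
  "pentagon_free S \<longleftrightarrow> (\<nexists>c0 c1 c2 c3 c4. pentagon S c0 c1 c2 c3 c4)"

definition admissible :: "'a set \<Rightarrow> bool" where
  "admissible S \<longleftrightarrow> finite S \<and> (\<forall>v\<in>S. card (nb S v) \<le> 3 \<and> large (list_size (card (nb S v))) (L v))"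

definition minimal_counterexample :: "'a set \<Rightarrow> bool" where
  "minimal_counterexample S \<longleftrightarrow> admissible S \<and> pentagon_free S \<and> (\<nexists>\<phi>. good S {} \<phi>) \<and>
     (\<forall>T. T \<subset> S \<longrightarrow> pentagon_free T \<longrightarrow> (\<exists>\<phi>. good T {} \<phi>))"

lemma nb_subset: "nb S v \<subseteq> S"
  by (auto simp: nb_def)

lemma nb_Diff: "nb (S - D) v = nb S v - D"
  by (auto simp: nb_def)

lemma nb_sym: "u \<in> nb S v \<Longrightarrow> v \<in> S \<Longrightarrow> v \<in> nb S u"
  by (auto simp: nb_def sym)

lemma nb_irrefl: "v \<notin> nb S v"
  by (auto simp: nb_def irrefl)

lemma nb_in: "u \<in> nb S v \<Longrightarrow> u \<in> S"
  by (auto simp: nb_def)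

lemma diverseI: "x \<in> nb S v \<Longrightarrow> y \<in> nb S v \<Longrightarrow> \<phi> x \<noteq> \<phi> y \<Longrightarrow> diverse S \<phi> v"
  by (auto simp: diverse_def)

lemma goodD:
  assumes "good S F \<phi>"
  shows "v \<in> S \<Longrightarrow> \<phi> v \<in> L v" "v \<in> S \<Longrightarrow> x \<in> nb S v \<Longrightarrow> \<phi> v \<noteq> \<phi> x"
    "v \<in> S \<Longrightarrow> v \<notin> F \<Longrightarrow> diverse S \<phi> v"
  using assms by (auto simp: good_def)

text \<open>
  The extension \<open>\<psi>\<close> of \<open>\<phi>\<close> to \<open>D\<close> has to be checked on \<open>D\<close>, at the exceptional vertices \<open>F\<close>, and
  at those neighbours of \<open>D\<close> that have at most one neighbour outside \<open>D\<close>: all other vertices keep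
  two neighbours of different colours.
\<close>
lemma good_extend:
  assumes g: "good (S - D) F \<phi>"
    and agree: "\<And>v. v \<in> S \<Longrightarrow> v \<notin> D \<Longrightarrow> \<psi> v = \<phi> v"
    and list: "\<And>v. v \<in> D \<Longrightarrow> \<psi> v \<in> L v"
    and proper: "\<And>v x. v \<in> D \<Longrightarrow> x \<in> nb S v \<Longrightarrow> \<psi> v \<noteq> \<psi> x"
    and div: "\<And>v. v \<in> D \<Longrightarrow> diverse S \<psi> v"
    and border: "\<And>v. v \<in> S \<Longrightarrow> v \<notin> D \<Longrightarrow>
      v \<in> F \<or> nb S v \<inter> D \<noteq> {} \<and> card (nb (S - D) v) < 2 \<Longrightarrow> diverse S \<psi> v"
  shows "good S {} \<psi>"
  unfolding good_def
proof (intro conjI ballI)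
  fix v assume v: "v \<in> S"
  show "\<psi> v \<in> L v"
    using v list agree goodD(1)[OF g] by (cases "v \<in> D") auto
next
  fix v x assume v: "v \<in> S" and x: "x \<in> nb S v"
  show "\<psi> v \<noteq> \<psi> x"
  proof (cases "v \<in> D \<or> x \<in> D")
    case True
    then show ?thesis using proper[of v x] proper[of x v] x v nb_sym by metis
  next
    case False
    then show ?thesis
      using v x agree goodD(2)[OF g, of v x] by (auto simp: nb_def)
  qed
next
  fix v assume v: "v \<in> S - {}"
  show "diverse S \<psi> v"
  proof (cases "v \<in> D \<or> v \<in> F \<or> nb S v \<inter> D \<noteq> {} \<and> card (nb (S - D) v) < 2")
    case True
    then show ?thesis using v div border by blast
  next
    case False
    have "diverse (S - D) \<phi> v" using goodD(3)[OF g, of v] v False by blast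
    moreover have "2 \<le> card (nb (S - D) v) \<or> nb (S - D) v = nb S v"
      using False by (auto simp: nb_Diff)
    ultimately show ?thesis
    proof (cases "2 \<le> card (nb (S - D) v)")
      case True
      then obtain x y where xy: "x \<in> nb (S - D) v" "y \<in> nb (S - D) v" "\<phi> x \<noteq> \<phi> y"
        using \<open>diverse (S - D) \<phi> v\<close> by (auto simp: diverse_def)
      then have "\<psi> x = \<phi> x" "\<psi> y = \<phi> y" using agree by (auto simp: nb_def)
      then show ?thesis using xy by (intro diverseI[of x _ _ y]) (auto simp: nb_def)
    qed (auto simp: diverse_def)
  qed
qed

lemma good_union:
  assumes A: "good A F \<phi>" and B: "good B G \<psi>" and disj: "A \<inter> B = {}"
    and no_edge: "\<And>x y. x \<in> A \<Longrightarrow> y \<in> B \<Longrightarrow> \<not> E x y"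
  shows "good (A \<union> B) (F \<union> G) (\<lambda>v. if v \<in> A then \<phi> v else \<psi> v)"
proof -
  have nbA: "nb (A \<union> B) v = nb A v" if "v \<in> A" for v
    using that no_edge by (auto simp: nb_def)
  have nbB: "nb (A \<union> B) v = nb B v" if "v \<in> B" for v
    using that no_edge sym by (auto simp: nb_def)
  have B': "x \<notin> A" if "x \<in> B" for x using that disj by blast
  show ?thesis
    unfolding good_def
  proof (intro conjI ballI)
    fix v assume "v \<in> A \<union> B"
    then show "(if v \<in> A then \<phi> v else \<psi> v) \<in> L v"
      using goodD(1)[OF A] goodD(1)[OF B] by auto
  next
    fix v x assume v: "v \<in> A \<union> B" and x: "x \<in> nb (A \<union> B) v"
    then show "(if v \<in> A then \<phi> v else \<psi> v) \<noteq> (if x \<in> A then \<phi> x else \<psi> x)"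
      using goodD(2)[OF A, of v x] goodD(2)[OF B, of v x] B' nbA[of v] nbB[of v] nb_in
      by (metis UnE)
  next
    fix v assume v: "v \<in> (A \<union> B) - (F \<union> G)"
    show "diverse (A \<union> B) (\<lambda>v. if v \<in> A then \<phi> v else \<psi> v) v"
    proof (cases "v \<in> A")
      case True
      have "\<And>x. x \<in> nb A v \<Longrightarrow> x \<in> A" by (auto simp: nb_def)
      then show ?thesis
        using goodD(3)[OF A, of v] True v by (auto simp: diverse_def nbA)
    next
      case False
      then have vB: "v \<in> B" using v by blast
      have "\<And>x. x \<in> nb B v \<Longrightarrow> x \<notin> A" using B' by (auto simp: nb_def)
      then show ?thesis
        using goodD(3)[OF B, of v] vB v by (auto simp: diverse_def nbB)
    qed
  qed
qed

lemma good_closed: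
  assumes "good (S - D) F \<phi>" "good D G \<psi>" "D \<subseteq> S" "\<And>v. v \<in> D \<Longrightarrow> nb S v \<subseteq> D"
  shows "\<exists>\<theta>. good S (F \<union> G) \<theta> \<and> (\<forall>v\<in>D. \<theta> v = \<psi> v)"
proof -
  have ne: "\<not> E x y" if "x \<in> D" "y \<in> S - D" for x y
    using that assms(4)[of x] by (auto simp: nb_def)
  have "D \<union> (S - D) = S" using assms(3) by blast
  then have "good S (F \<union> G) (\<lambda>v. if v \<in> D then \<psi> v else \<phi> v)"
    using good_union[OF assms(2,1) _ ne] by (simp add: Un_commute)
  then show ?thesis by auto
qed

lemma pentagon_rotate: "pentagon S c0 c1 c2 c3 c4 \<Longrightarrow> pentagon S c1 c2 c3 c4 c0"
  unfolding pentagon_def by auto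

lemma pentagon_in:
  assumes "pentagon S c0 c1 c2 c3 c4"
  shows "{c0, c1, c2, c3, c4} \<subseteq> S"
proof -
  have "c0 \<in> nb S c1" "c1 \<in> nb S c0" "c2 \<in> nb S c1" "c3 \<in> nb S c2" "c4 \<in> nb S c0"
    using assms by (simp_all add: pentagon_def)
  then show ?thesis by (simp add: nb_in)
qed

lemma pentagon_card:
  assumes "pentagon S c0 c1 c2 c3 c4" "x \<in> {c0, c1, c2, c3, c4}"
  shows "card (nb S x) = 2"
  using assms unfolding pentagon_def by auto

lemma pentagon_at:
  assumes p: "pentagon S c0 c1 c2 c3 c4" and x: "x \<in> {c0, c1, c2, c3, c4}"
  obtains d1 d2 d3 d4 where "pentagon S x d1 d2 d3 d4" "{x, d1, d2, d3, d4} = {c0, c1, c2, c3, c4}"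
proof -
  note r = pentagon_rotate
  note p1 = r[OF p] note p2 = r[OF p1] note p3 = r[OF p2] note p4 = r[OF p3]
  consider "x = c0" | "x = c1" | "x = c2" | "x = c3" | "x = c4" using x by blast
  then show thesis
  proof cases
    case 1 show thesis by (rule that[of c1 c2 c3 c4]) (use 1 p in auto)
  next
    case 2 show thesis by (rule that[of c2 c3 c4 c0]) (use 2 p1 in auto)
  next
    case 3 show thesis by (rule that[of c3 c4 c0 c1]) (use 3 p2 in auto)
  next
    case 4 show thesis by (rule that[of c4 c0 c1 c2]) (use 4 p3 in auto)
  next
    case 5 show thesis by (rule that[of c0 c1 c2 c3]) (use 5 p4 in auto)
  qed
qed

section \<open>Minimal counterexamples\<close>

lemma minimal_counterexampleD:
  assumes "minimal_counterexample S"
  shows "finite S" "finite (nb S v)" "v \<in> S \<Longrightarrow> card (nb S v) \<le> 3"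
    "v \<in> S \<Longrightarrow> large (list_size (card (nb S v))) (L v)"
    "pentagon_free S" "\<not> good S {} \<phi>"
  using assms finite_subset[OF nb_subset, of S v] by (auto simp: minimal_counterexample_def admissible_def)

lemma minimal_IH:
  assumes "minimal_counterexample S" "D \<inter> S \<noteq> {}" "pentagon_free (S - D)"
  obtains \<phi> where "good (S - D) {} \<phi>"
proof -
  have "S - D \<subset> S" using assms(2) by blast
  then have "\<exists>\<phi>. good (S - D) {} \<phi>" using assms(1,3) unfolding minimal_counterexample_def by blast
  then show thesis using that by blast
qed

lemma minimal_large4:
  assumes "minimal_counterexample S" "v \<in> S" "2 \<le> card (nb S v)"
  shows "large 4 (L v)"
proof -
  have "4 \<le> list_size (card (nb S v))" using assms(3) by (auto simp: list_size_def)
  then show ?thesis using minimal_counterexampleD(4)[OF assms(1,2)] large_mono by blast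
qed

text \<open>Otherwise the 5-cycle would already be a component of \<open>S\<close>.\<close>
lemma pentagon_exit:
  assumes m: "minimal_counterexample S" and p: "pentagon (S - D) c0 c1 c2 c3 c4"
  obtains x where "x \<in> {c0, c1, c2, c3, c4}" "nb S x \<inter> D \<noteq> {}"
proof (rule ccontr)
  assume "\<not> thesis"
  then have "\<And>x. x \<in> {c0, c1, c2, c3, c4} \<Longrightarrow> nb S x = nb (S - D) x"
    using that by (auto simp: nb_Diff)
  then have "pentagon S c0 c1 c2 c3 c4" using p by (simp add: pentagon_def)
  then show False using minimal_counterexampleD(5)[OF m] by (auto simp: pentagon_free_def)
qed

text \<open>
  The constraints inside the path \<open>x1 x2 x3 x4\<close> are the edges of \<open>K\<^sub>4\<close> without \<open>x1 x4\<close>. The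
  colours of \<open>p\<close> and \<open>q\<close> are forbidden to \<open>x1, x2\<close> and to \<open>x3, x4\<close>. Forbidding to \<open>x1\<close> the
  colour of a further neighbour \<open>p'\<close> of \<open>p\<close> settles the condition at \<open>p\<close>, and likewise for
  \<open>x4\<close>, \<open>q\<close> and \<open>q'\<close>. Lists of sizes 2, 3, 3, 2 remain. As \<open>p\<close> and \<open>q\<close> keep at most one
  neighbour, they do not lie on a 5-cycle component after the deletion. The case \<open>p = q\<close> is a
  5-cycle attached to the rest at \<open>p\<close>.
\<close>
lemma path4_reducible:
  assumes m: "minimal_counterexample S" and X: "X = {x1, x2, x3, x4}" and d: "distinct [x1, x2, x3, x4]"
    and xS: "X \<subseteq> S"
    and nx: "nb S x1 = {p, x2}" "nb S x2 = {x1, x3}" "nb S x3 = {x2, x4}" "nb S x4 = {x3, q}"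
    and pq: "p \<notin> X" "q \<notin> X"
    and p': "p' \<in> nb S p" "p' \<notin> X" and q': "q' \<in> nb S q" "q' \<notin> X"
    and deg: "card (nb (S - X) p) \<le> 1" "card (nb (S - X) q) \<le> 1"
  shows False
proof -
  have border: "v = p \<or> v = q" if v: "v \<in> S" "v \<notin> X" "nb S v \<inter> X \<noteq> {}" for v
  proof -
    obtain x where "x \<in> X" "x \<in> nb S v" using v by blast
    then have "v \<in> nb S x" using nb_sym v by blast
    then show ?thesis using \<open>x \<in> X\<close> nx v(2) unfolding X by auto
  qed
  have "pentagon_free (S - X)"
  proof (rule ccontr)
    assume "\<not> ?thesis"
    then obtain c0 c1 c2 c3 c4 where c: "pentagon (S - X) c0 c1 c2 c3 c4"
      by (auto simp: pentagon_free_def)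
    obtain x where x: "x \<in> {c0, c1, c2, c3, c4}" "nb S x \<inter> X \<noteq> {}"
      using pentagon_exit[OF m c] .
    then show False
      using border[of x] pentagon_card[OF c x(1)] pentagon_in[OF c] deg by auto
  qed
  then obtain \<phi> where g: "good (S - X) {} \<phi>"
    using minimal_IH[OF m, of X] xS unfolding X by blast
  have l: "large 4 (L x)" if "x \<in> X" for x
    using minimal_large4[OF m, of x] that xS nx d pq unfolding X by auto
  have lx: "large 4 (L x1)" "large 4 (L x2)" "large 4 (L x3)" "large 4 (L x4)"
    using l unfolding X by simp_all
  obtain y1 y2 y3 y4 where
    y: "y1 \<in> L x1 - {\<phi> p, \<phi> p'}" "y2 \<in> L x2 - {\<phi> p}" "y3 \<in> L x3 - {\<phi> q}"
      "y4 \<in> L x4 - {\<phi> q, \<phi> q'}" "y1 \<noteq> y2" "y1 \<noteq> y3" "y2 \<noteq> y3" "y2 \<noteq> y4" "y3 \<noteq> y4"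
    by (rule diamond_colouring[OF large_remove2[OF lx(1), of "\<phi> p" "\<phi> p'"]
      large_remove1[OF lx(2), of "\<phi> p"] large_remove1[OF lx(3), of "\<phi> q"]
      large_remove2[OF lx(4), of "\<phi> q" "\<phi> q'"]]) blast
  define \<psi> where "\<psi> = \<phi>(x1 := y1, x2 := y2, x3 := y3, x4 := y4)"
  have \<psi>x: "\<psi> x1 = y1" "\<psi> x2 = y2" "\<psi> x3 = y3" "\<psi> x4 = y4"
    using d by (auto simp: \<psi>_def)
  have \<psi>o: "\<psi> v = \<phi> v" if "v \<notin> X" for v using that by (auto simp: \<psi>_def X)
  have "good S {} \<psi>"
  proof (rule good_extend[OF g])
    fix v x assume "v \<in> X" "x \<in> nb S v"
    then show "\<psi> v \<noteq> \<psi> x" using y nx \<psi>x \<psi>o[OF pq(1)] \<psi>o[OF pq(2)] unfolding X by auto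
  next
    fix v assume "v \<in> X"
    then consider "v = x1" | "v = x2" | "v = x3" | "v = x4" unfolding X by blast
    then show "diverse S \<psi> v"
      by cases (use y nx \<psi>x \<psi>o[OF pq(1)] \<psi>o[OF pq(2)] in \<open>auto intro: diverseI simp: diverse_def\<close>)
  next
    fix v assume v: "v \<in> S" "v \<notin> X" "v \<in> {} \<or> nb S v \<inter> X \<noteq> {} \<and> card (nb (S - X) v) < 2"
    then have "v = p \<or> v = q" using border by blast
    then show "diverse S \<psi> v"
    proof
      assume [simp]: "v = p"
      have "x1 \<in> nb S p" using nx nb_sym[of p S x1] xS X by auto
      then show ?thesis using diverseI[of x1 S p p' \<psi>] p' \<psi>x \<psi>o y by auto
    next
      assume [simp]: "v = q"
      have "x4 \<in> nb S q" using nx nb_sym[of q S x4] xS X by auto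
      then show ?thesis using diverseI[of x4 S q q' \<psi>] q' \<psi>x \<psi>o y by auto
    qed
  qed (use y \<psi>x \<psi>o in \<open>auto simp: X\<close>)
  then show False using minimal_counterexampleD(6)[OF m] by blast
qed

lemma exit_degree:
  assumes m: "minimal_counterexample S" and p: "pentagon (S - D) c0 c1 c2 c3 c4"
    and x: "x \<in> {c0, c1, c2, c3, c4}" "nb S x \<inter> D \<noteq> {}"
  shows "card (nb S x) = 3" "card (nb S x \<inter> D) = 1"
proof -
  have "card (nb S x) = card (nb (S - D) x) + card (nb S x \<inter> D)"
    using card_Int_Diff[OF minimal_counterexampleD(2)[OF m, of x], of D] by (simp add: nb_Diff)
  moreover have "card (nb S x \<inter> D) \<noteq> 0" using x(2) minimal_counterexampleD(2)[OF m] by auto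
  moreover have "card (nb S x) \<le> 3" using pentagon_in[OF p] x minimal_counterexampleD(3)[OF m] by blast
  ultimately show "card (nb S x) = 3" "card (nb S x \<inter> D) = 1"
    using pentagon_card[OF p x(1)] by auto
qed

text \<open>
  If \<open>x\<close> were the only vertex of the 5-cycle with a neighbour \<open>w\<close> in \<open>D\<close>, then the other four
  would be a reducible path with \<open>p = q = x\<close> and \<open>p' = q' = w\<close>.
\<close>
lemma pentagon_two_exits:
  assumes m: "minimal_counterexample S" and p: "pentagon (S - D) c0 c1 c2 c3 c4"
  obtains x y where "x \<in> {c0, c1, c2, c3, c4}" "y \<in> {c0, c1, c2, c3, c4}" "x \<noteq> y"
    "nb S x \<inter> D \<noteq> {}" "nb S y \<inter> D \<noteq> {}"
proof (rule ccontr)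
  assume contra: "\<not> thesis"
  note exits = that
  obtain x where x: "x \<in> {c0, c1, c2, c3, c4}" "nb S x \<inter> D \<noteq> {}"
    using pentagon_exit[OF m p] .
  obtain d1 d2 d3 d4 where d: "pentagon (S - D) x d1 d2 d3 d4"
    "{x, d1, d2, d3, d4} = {c0, c1, c2, c3, c4}"
    using pentagon_at[OF p x(1)] .
  let ?X = "{d1, d2, d3, d4}"
  have ds: "distinct [x, d1, d2, d3, d4]" using d(1) unfolding pentagon_def by blast
  have same: "nb S y = nb (S - D) y" if y: "y \<in> ?X" for y
  proof -
    have "y \<in> {x, d1, d2, d3, d4}" "x \<noteq> y" using y ds by auto
    then have "nb S y \<inter> D = {}" using contra exits[OF x(1) _ _ x(2)] unfolding d(2) by blast
    then show ?thesis by (auto simp: nb_Diff)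
  qed
  obtain w where w: "w \<in> nb S x" "w \<in> D" using x(2) by blast
  have dS: "{x, d1, d2, d3, d4} \<subseteq> S - D" using pentagon_in[OF d(1)] .
  have nx: "nb (S - D) x = {d4, d1}" using d(1) by (simp add: pentagon_def)
  have sub: "nb S x - ?X = nb S x \<inter> D"
    using nx dS d(1) by (auto simp: nb_Diff pentagon_def)
  have deg: "card (nb (S - ?X) x) \<le> 1"
    using exit_degree(2)[OF m p x] sub by (simp add: nb_Diff)
  show False
    by (rule path4_reducible[OF m refl, of d1 d2 d3 d4 x x w w])
      (use ds dS w deg same d(1) in \<open>auto simp: pentagon_def\<close>)
qed


section \<open>Leaves and adjacent vertices of degree 2\<close>

lemma other_neighbour:
  assumes "card (nb S v) = 2" "a \<in> nb S v"
  obtains b where "nb S v = {a, b}" "a \<noteq> b"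
proof -
  obtain x y where xy: "nb S v = {x, y}" "x \<noteq> y" using assms(1) unfolding card_2_iff by blast
  show thesis
  proof (cases "a = x")
    case True
    then show thesis using xy by (intro that[of y]) auto
  next
    case False
    then show thesis using xy assms(2) by (intro that[of x]) auto
  qed
qed

lemma other_neighbours:
  assumes "card (nb S v) = 3" "a \<in> nb S v"
  obtains b c where "nb S v = {a, b, c}" "a \<noteq> b" "a \<noteq> c" "b \<noteq> c"
proof -
  have "card (nb S v - {a}) = 2" using assms by simp
  then obtain b c where "nb S v - {a} = {b, c}" "b \<noteq> c" unfolding card_2_iff by blast
  then show thesis using assms(2) by (intro that[of b c]) auto
qed

text \<open>
  Let \<open>v\<close> have degree at most 1. If its neighbour does not have degree 2, then colouring \<open>v\<close> last
  works. If its neighbour \<open>u\<close> has degree 2 and second neighbour \<open>w\<close>, then both \<open>u\<close> and \<open>v\<close> are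
  deleted, because \<open>v\<close>, with a list of size 2, must differ from \<open>w\<close> as well as from \<open>u\<close>. No 5-cycle
  is left behind, as it would be attached to the deleted set at one vertex only.
\<close>
lemma minimal_degree_ge_2:
  assumes m: "minimal_counterexample S" and v: "v \<in> S"
  shows "2 \<le> card (nb S v)"
proof (rule ccontr)
  assume "\<not> ?thesis"
  then have small: "card (nb S v) \<le> 1" by simp
  have fin: "finite (nb S v)" using minimal_counterexampleD(2)[OF m] .
  show False
  proof (cases "\<exists>u\<in>nb S v. card (nb S u) = 2")
    case False
    have "pentagon_free (S - {v})"
    proof (rule ccontr)
      assume "\<not> ?thesis"
      then obtain c0 c1 c2 c3 c4 where c: "pentagon (S - {v}) c0 c1 c2 c3 c4"
        by (auto simp: pentagon_free_def)
      obtain x y where xy: "x \<in> {c0, c1, c2, c3, c4}" "y \<in> {c0, c1, c2, c3, c4}" "x \<noteq> y"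
        "nb S x \<inter> {v} \<noteq> {}" "nb S y \<inter> {v} \<noteq> {}"
        using pentagon_two_exits[OF m c] .
      then have "x \<in> S" "y \<in> S" "v \<in> nb S x" "v \<in> nb S y" using pentagon_in[OF c] by auto
      then have "{x, y} \<subseteq> nb S v" using nb_sym by blast
      then have "card {x, y} \<le> card (nb S v)" using fin card_mono by blast
      then show False using xy(3) small by auto
    qed
    then obtain \<phi> where g: "good (S - {v}) {} \<phi>"
      using minimal_IH[OF m, of "{v}"] v by blast
    have "card (\<phi> ` nb S v) < list_size (card (nb S v))"
      using card_image_le[OF fin, of \<phi>] by (auto simp: list_size_def)
    then obtain y where y: "y \<in> L v" "y \<notin> \<phi> ` nb S v"
      using large_pick[OF minimal_counterexampleD(4)[OF m v]] fin by blast
    have "good S {} (\<phi>(v := y))"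
    proof (rule good_extend[OF g])
      fix w assume w: "w \<in> S" "w \<notin> {v}"
        "w \<in> {} \<or> nb S w \<inter> {v} \<noteq> {} \<and> card (nb (S - {v}) w) < 2"
      then have "w \<in> nb S v" using nb_sym by blast
      moreover have "card (nb S w) \<le> 2"
        using w minimal_counterexampleD(2)[OF m, of w] by (auto simp: nb_Diff card_Diff_singleton_if split: if_splits)
      ultimately show "diverse S (\<phi>(v := y)) w" using False by (force simp: diverse_def)
    qed (use y small nb_irrefl[of v] in \<open>auto simp: diverse_def\<close>)
    then show False using minimal_counterexampleD(6)[OF m] by blast
  next
    case True
    then obtain u where u: "u \<in> nb S v" "card (nb S u) = 2" by blast
    have "x = u" if "x \<in> nb S v" for x
      using card_le_Suc0_iff_eq[OF fin] small u(1) that by simp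
    then have nv: "nb S v = {u}" using u(1) by blast
    have uS: "u \<in> S" and vu: "v \<in> nb S u" using nb_in[OF u(1)] nb_sym[OF u(1) v] .
    obtain w where w: "nb S u = {v, w}" "v \<noteq> w" using other_neighbour[OF u(2) vu] .
    have wS: "w \<in> S" using w nb_in[of w] by blast
    have uv: "u \<noteq> v" "u \<noteq> w" using vu w nb_irrefl[of u] by auto
    have uw: "u \<in> nb S w" using nb_sym[of w S u] w uS by simp
    let ?D = "{u, v}"
    have border: "x = w" if "x \<in> S" "x \<notin> ?D" "nb S x \<inter> ?D \<noteq> {}" for x
    proof -
      have "x \<in> nb S u \<or> x \<in> nb S v" using that nb_sym[of _ S x] by blast
      then show ?thesis using that w nv by auto
    qed
    have "pentagon_free (S - ?D)"
    proof (rule ccontr)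
      assume "\<not> ?thesis"
      then obtain c0 c1 c2 c3 c4 where c: "pentagon (S - ?D) c0 c1 c2 c3 c4"
        by (auto simp: pentagon_free_def)
      obtain x y where xy: "x \<in> {c0, c1, c2, c3, c4}" "y \<in> {c0, c1, c2, c3, c4}" "x \<noteq> y"
        "nb S x \<inter> ?D \<noteq> {}" "nb S y \<inter> ?D \<noteq> {}"
        using pentagon_two_exits[OF m c] .
      have "x = w" "y = w" using border xy pentagon_in[OF c] by blast+
      then show False using xy(3) by simp
    qed
    then obtain \<phi> where g: "good (S - ?D) {} \<phi>"
      using minimal_IH[OF m, of ?D] v by blast
    \<comment> \<open>If \<open>u\<close> avoids the colour \<open>c\<close> of some other neighbour of \<open>w\<close>, then \<open>w\<close> is satisfied.\<close>
    obtain c where c: "nb (S - ?D) w = {} \<or> (\<exists>w'\<in>nb (S - ?D) w. \<phi> w' = c)" by blast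
    have "list_size 1 = 2" by (simp add: list_size_def)
    then have "large 2 (L v)" using minimal_counterexampleD(4)[OF m v] nv by simp
    then obtain b where b: "b \<in> L v" "b \<noteq> \<phi> w" using large_pick1[of "L v" "\<phi> w"] by blast
    obtain a where a: "a \<in> L u" "a \<noteq> \<phi> w" "a \<noteq> c" "a \<noteq> b"
      using large_pick3[OF minimal_large4[OF m uS], of "\<phi> w" c b] u(2) by auto
    define \<psi> where "\<psi> = \<phi>(u := a, v := b)"
    have \<psi>: "\<psi> u = a" "\<psi> v = b" "\<psi> w = \<phi> w" using uv w(2) by (auto simp: \<psi>_def)
    have "good S {} \<psi>"
    proof (rule good_extend[OF g])
      fix x assume x: "x \<in> S" "x \<notin> ?D"
        "x \<in> {} \<or> nb S x \<inter> ?D \<noteq> {} \<and> card (nb (S - ?D) x) < 2"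
      then have [simp]: "x = w" using border by blast
      show "diverse S \<psi> x"
      proof (cases "nb (S - ?D) w = {}")
        case True
        have "v \<notin> nb S w" using nb_sym[of v S w] wS nv uv by auto
        then have "nb S w \<subseteq> {u}" using True by (auto simp: nb_Diff)
        then have "card (nb S w) \<le> 1" using card_mono[of "{u}"] by fastforce
        then show ?thesis by (auto simp: diverse_def)
      next
        case False
        then obtain w' where w': "w' \<in> nb (S - ?D) w" "\<phi> w' = c" using c by blast
        then have "\<psi> w' = c" "w' \<in> nb S w" by (auto simp: \<psi>_def nb_def)
        then show ?thesis using diverseI[OF uw, of w' \<psi>] a \<psi> by simp
      qed
    next
      fix x assume "x \<in> ?D"
      then consider "x = u" | "x = v" by blast
      then show "diverse S \<psi> x"
      proof cases
        case 1
        then show ?thesis using diverseI[of v S u w \<psi>] w \<psi> b by simp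
      next
        case 2
        then show ?thesis using nv by (simp add: diverse_def)
      qed
    qed (use a b \<psi> w nv in \<open>auto simp: \<psi>_def\<close>)
    then show False using minimal_counterexampleD(6)[OF m] by blast
  qed
qed

text \<open>
  On a 5-cycle any two vertices are adjacent or have a common neighbour. Without the condition at
  \<open>c0\<close>, the vertices \<open>c1\<close> and \<open>c4\<close> may agree; once \<open>c0\<close> is coloured, the other four are in the
  situation of \<open>diamond_colouring\<close>.
\<close>
lemma pentagon_colouring:
  assumes p: "pentagon S c0 c1 c2 c3 c4"
    and l: "\<And>x. x \<in> {c0, c1, c2, c3, c4} \<Longrightarrow> large 4 (L x)"
  obtains \<phi> where "good {c0, c1, c2, c3, c4} {c0} \<phi>"
    "\<And>x y. x \<in> {c0, c1, c2, c3, c4} \<Longrightarrow> y \<in> {c0, c1, c2, c3, c4} \<Longrightarrow> x \<noteq> y \<Longrightarrow>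
      {x, y} \<noteq> {c1, c4} \<Longrightarrow> \<phi> x \<noteq> \<phi> y"
proof -
  let ?T = "{c0, c1, c2, c3, c4}"
  have d: "distinct [c0, c1, c2, c3, c4]" using p by (simp add: pentagon_def)
  obtain y0 where y0: "y0 \<in> L c0" using large_pick1[OF large_mono, of 4 "L c0"] l[of c0] by auto
  have l2: "large 2 (L x - {y0})" and l3: "large 3 (L x - {y0})" if "x \<in> ?T" for x
    using large_remove1[OF l[OF that], of y0] large_mono[of 3 _ 2] by auto
  obtain y1 y2 y3 y4 where
    y: "y1 \<in> L c1 - {y0}" "y2 \<in> L c2 - {y0}" "y3 \<in> L c3 - {y0}" "y4 \<in> L c4 - {y0}"
      "y1 \<noteq> y2" "y1 \<noteq> y3" "y2 \<noteq> y3" "y2 \<noteq> y4" "y3 \<noteq> y4"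
    by (rule diamond_colouring[OF l2[of c1] l3[of c2] l3[of c3] l2[of c4]]) blast+
  define \<phi> where "\<phi> = (\<lambda>_. y0)(c1 := y1, c2 := y2, c3 := y3, c4 := y4)"
  have \<phi>: "\<phi> c0 = y0" "\<phi> c1 = y1" "\<phi> c2 = y2" "\<phi> c3 = y3" "\<phi> c4 = y4"
    using d by (auto simp: \<phi>_def)
  have sep: "\<phi> x \<noteq> \<phi> y" if "x \<in> ?T" "y \<in> ?T" "x \<noteq> y" "{x, y} \<noteq> {c1, c4}" for x y
    using that \<phi> y by auto
  have nT: "nb ?T x = nb S x" if "x \<in> ?T" for x
  proof -
    have "nb S x \<subseteq> ?T" using that p by (auto simp: pentagon_def)
    then show ?thesis using pentagon_in[OF p] by (auto simp: nb_def)
  qed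
  have "good ?T {c0} \<phi>"
    unfolding good_def
  proof (intro conjI ballI)
    fix x assume "x \<in> ?T"
    then show "\<phi> x \<in> L x" using y y0 \<phi> by auto
  next
    fix v x assume v: "v \<in> ?T" and "x \<in> nb ?T v"
    then have "x \<in> nb S v" using nT by blast
    then show "\<phi> v \<noteq> \<phi> x" using v p \<phi> y unfolding pentagon_def by auto
  next
    fix v assume v: "v \<in> ?T - {c0}"
    then consider "v = c1" | "v = c2" | "v = c3" | "v = c4" by blast
    then show "diverse ?T \<phi> v"
    proof cases
      case 1
      then show ?thesis using nT[of v] p \<phi> y
        by (intro diverseI[of c0 _ _ c2]) (auto simp: pentagon_def)
    next
      case 2
      then show ?thesis using nT[of v] p \<phi> y
        by (intro diverseI[of c1 _ _ c3]) (auto simp: pentagon_def)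
    next
      case 3
      then show ?thesis using nT[of v] p \<phi> y
        by (intro diverseI[of c2 _ _ c4]) (auto simp: pentagon_def)
    next
      case 4
      then show ?thesis using nT[of v] p \<phi> y
        by (intro diverseI[of c3 _ _ c0]) (auto simp: pentagon_def)
    qed
  qed
  then show thesis using that sep by blast
qed

text \<open>
  All neighbours of \<open>D\<close> lie on the 5-cycle, so what remains after deleting \<open>D\<close> and the 5-cycle is a
  union of components of \<open>S\<close> and is coloured by minimality.
\<close>
lemma pentagon_split:
  assumes m: "minimal_counterexample S" and D: "D \<inter> S \<noteq> {}" and p: "pentagon (S - D) c0 c1 c2 c3 c4"
    and border: "\<And>x. x \<in> S \<Longrightarrow> x \<notin> D \<Longrightarrow> nb S x \<inter> D \<noteq> {} \<Longrightarrow> x \<in> {c0, c1, c2, c3, c4}"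
  obtains \<phi> where "good (S - D) {c0} \<phi>"
    "\<And>x y. x \<in> {c0, c1, c2, c3, c4} \<Longrightarrow> y \<in> {c0, c1, c2, c3, c4} \<Longrightarrow> x \<noteq> y \<Longrightarrow>
      {x, y} \<noteq> {c1, c4} \<Longrightarrow> \<phi> x \<noteq> \<phi> y"
proof -
  let ?T = "{c0, c1, c2, c3, c4}"
  have TS: "?T \<subseteq> S - D" using pentagon_in[OF p] .
  have closed: "nb (S - D) x \<subseteq> ?T" if "x \<in> ?T" for x
    using that p by (auto simp: pentagon_def)
  have l: "large 4 (L x)" if x: "x \<in> ?T" for x
  proof (rule minimal_large4[OF m])
    show "x \<in> S" using x TS by blast
    then show "2 \<le> card (nb S x)" using minimal_degree_ge_2[OF m] by blast
  qed
  obtain \<psi> where g: "good ?T {c0} \<psi>" and sep: "\<And>x y. x \<in> ?T \<Longrightarrow> y \<in> ?T \<Longrightarrow> x \<noteq> y \<Longrightarrow>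
      {x, y} \<noteq> {c1, c4} \<Longrightarrow> \<psi> x \<noteq> \<psi> y"
    by (rule pentagon_colouring[OF p l]) blast+
  have "pentagon_free (S - (D \<union> ?T))"
  proof (rule ccontr)
    assume "\<not> ?thesis"
    then obtain b0 b1 b2 b3 b4 where b: "pentagon (S - (D \<union> ?T)) b0 b1 b2 b3 b4"
      by (auto simp: pentagon_free_def)
    obtain x where x: "x \<in> {b0, b1, b2, b3, b4}" "nb S x \<inter> (D \<union> ?T) \<noteq> {}"
      using pentagon_exit[OF m b] .
    then have xS: "x \<in> S - (D \<union> ?T)" using pentagon_in[OF b] by blast
    then have "nb S x \<inter> D = {}" using border[of x] by blast
    then obtain t where t: "t \<in> nb S x" "t \<in> ?T" using x(2) by blast
    then have "x \<in> nb S t" using nb_sym xS by blast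
    then show False using closed[OF t(2)] xS by (auto simp: nb_Diff)
  qed
  then obtain \<phi> where "good (S - (D \<union> ?T)) {} \<phi>"
    using minimal_IH[OF m, of "D \<union> ?T"] TS by blast
  moreover have "S - (D \<union> ?T) = S - D - ?T" by blast
  ultimately have "good (S - D - ?T) {} \<phi>" by simp
  then obtain \<theta> where \<theta>: "good (S - D) ({} \<union> {c0}) \<theta>" "\<forall>v\<in>?T. \<theta> v = \<psi> v"
    using good_closed[OF _ g TS closed] by blast
  have "\<theta> x \<noteq> \<theta> y" if "x \<in> ?T" "y \<in> ?T" "x \<noteq> y" "{x, y} \<noteq> {c1, c4}" for x y
    using sep[OF that] \<theta>(2) that(1,2) by metis
  moreover have "good (S - D) {c0} \<theta>" using \<theta>(1) by simp
  ultimately show thesis using that by blast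
qed

text \<open>
  The pair \<open>u, v\<close> is deleted. Each of the two must avoid the colours of \<open>a\<close> and \<open>b\<close>, and they must
  differ. If \<open>u\<close> also avoids the colour of some further neighbour of \<open>a\<close>, then \<open>a\<close> is
  satisfied, whatever happened at \<open>a\<close> before; \<open>b\<close> is satisfied because it has degree 3. A 5-cycle
  left behind contains both \<open>a\<close> and \<open>b\<close>, and is coloured with \<open>a\<close> as the exceptional vertex.
\<close>
lemma deg2_pair_reducible:
  assumes m: "minimal_counterexample S" and uS: "u \<in> S" and vS: "v \<in> S"
    and nu: "nb S u = {a, v}" "a \<noteq> v" and nv: "nb S v = {u, b}" "b \<noteq> u"
    and degb: "card (nb S b) = 3"
  shows False
proof -
  let ?D = "{u, v}"
  have au: "a \<noteq> u" "u \<noteq> v" using nb_irrefl[of u S] nu by auto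
  have bv: "b \<noteq> v" using nb_irrefl[of v S] nv by auto
  have aS: "a \<in> S" and bS: "b \<in> S" using nb_in[of a S u] nb_in[of b S v] nu nv by auto
  have ua: "u \<in> nb S a" and vb: "v \<in> nb S b"
    using nb_sym[of a S u] nb_sym[of b S v] nu nv uS vS by auto
  have border: "x = a \<or> x = b" if "x \<in> S" "x \<notin> ?D" "nb S x \<inter> ?D \<noteq> {}" for x
  proof -
    have "x \<in> nb S u \<or> x \<in> nb S v" using that nb_sym[of _ S x] by blast
    then show ?thesis using that nu nv by auto
  qed
  obtain \<phi> where g: "good (S - ?D) {a} \<phi>"
  proof (cases "pentagon_free (S - ?D)")
    case True
    then obtain \<phi> where "good (S - ?D) {} \<phi>" using minimal_IH[OF m, of ?D] uS by blast
    then have "good (S - ?D) {a} \<phi>" by (simp add: good_def)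
    then show thesis using that by blast
  next
    case False
    then obtain c0 c1 c2 c3 c4 where c: "pentagon (S - ?D) c0 c1 c2 c3 c4"
      by (auto simp: pentagon_free_def)
    obtain x y where xy: "x \<in> {c0, c1, c2, c3, c4}" "y \<in> {c0, c1, c2, c3, c4}" "x \<noteq> y"
      "nb S x \<inter> ?D \<noteq> {}" "nb S y \<inter> ?D \<noteq> {}"
      using pentagon_two_exits[OF m c] .
    have "x = a \<or> x = b" "y = a \<or> y = b" using border xy pentagon_in[OF c] by blast+
    then have ab: "a \<in> {c0, c1, c2, c3, c4}" "b \<in> {c0, c1, c2, c3, c4}" using xy by metis+
    obtain d1 d2 d3 d4 where d: "pentagon (S - ?D) a d1 d2 d3 d4"
      "{a, d1, d2, d3, d4} = {c0, c1, c2, c3, c4}"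
      using pentagon_at[OF c ab(1)] .
    have T: "x \<in> {a, d1, d2, d3, d4}" if "x \<in> S" "x \<notin> ?D" "nb S x \<inter> ?D \<noteq> {}" for x
      using border[OF that] ab unfolding d(2) by blast
    have "?D \<inter> S \<noteq> {}" using uS by blast
    then obtain \<phi> where "good (S - ?D) {a} \<phi>"
      using pentagon_split[OF m _ d(1) T] by metis
    then show thesis by (rule that)
  qed
  obtain c where c: "nb (S - ?D) a = {} \<or> (\<exists>a'\<in>nb (S - ?D) a. \<phi> a' = c)" by blast
  have "card (nb S u) = 2" "card (nb S v) = 2" using nu nv by auto
  then have lu: "large 4 (L u)" and lv: "large 4 (L v)"
    using minimal_large4[OF m] uS vS by auto
  obtain \<alpha> where \<alpha>: "\<alpha> \<in> L u" "\<alpha> \<noteq> \<phi> a" "\<alpha> \<noteq> \<phi> b" "\<alpha> \<noteq> c"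
    using large_pick3[OF lu] by blast
  obtain \<beta> where \<beta>: "\<beta> \<in> L v" "\<beta> \<noteq> \<phi> a" "\<beta> \<noteq> \<phi> b" "\<beta> \<noteq> \<alpha>"
    using large_pick3[OF lv] by blast
  define \<psi> where "\<psi> = \<phi>(u := \<alpha>, v := \<beta>)"
  have \<psi>: "\<psi> u = \<alpha>" "\<psi> v = \<beta>" "\<psi> a = \<phi> a" "\<psi> b = \<phi> b"
    using au nu bv nv by (auto simp: \<psi>_def)
  have "good S {} \<psi>"
  proof (rule good_extend[OF g])
    fix x assume "x \<in> ?D"
    then consider "x = u" | "x = v" by blast
    then show "diverse S \<psi> x"
    proof cases
      case 1
      then show ?thesis using diverseI[of a S u v \<psi>] nu \<psi> \<beta> by simp
    next
      case 2
      then show ?thesis using diverseI[of u S v b \<psi>] nv \<psi> \<alpha> by simp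
    qed
  next
    fix x assume x: "x \<in> S" "x \<notin> ?D"
      "x \<in> {a} \<or> nb S x \<inter> ?D \<noteq> {} \<and> card (nb (S - ?D) x) < 2"
    show "diverse S \<psi> x"
    proof (cases "a = b")
      case True
      then have "x = a" using border x by blast
      then show ?thesis using diverseI[OF ua, of v \<psi>] vb True \<psi> \<beta> by simp
    next
      case ab: False
      have va: "v \<notin> nb S a" using nb_sym[of v S a] aS nv au ab by auto
      have ub: "u \<notin> nb S b" using nb_sym[of u S b] bS nu bv ab by auto
      show ?thesis
      proof (cases "x = a")
        case [simp]: True
        show ?thesis
        proof (cases "nb (S - ?D) a = {}")
          case True
          then have "nb S a \<subseteq> {u}" using va by (auto simp: nb_Diff)
          then have "card (nb S a) \<le> 1" using card_mono[of "{u}"] by fastforce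
          then show ?thesis by (auto simp: diverse_def)
        next
          case False
          then obtain a' where a': "a' \<in> nb (S - ?D) a" "\<phi> a' = c" using c by blast
          then have "\<psi> a' = c" "a' \<in> nb S a" by (auto simp: \<psi>_def nb_def)
          then show ?thesis using diverseI[OF ua, of a' \<psi>] \<alpha> \<psi> by simp
        qed
      next
        case False
        then have "x = b" "card (nb (S - ?D) x) < 2" using border x by blast+
        moreover have "nb (S - ?D) b = nb S b - {v}" using ub by (auto simp: nb_Diff)
        ultimately show ?thesis using degb vb by simp
      qed
    qed
  qed (use \<alpha> \<beta> \<psi> nu nv in \<open>auto simp: \<psi>_def\<close>)
  then show False using minimal_counterexampleD(6)[OF m] by blast
qed

lemma closed_set_colouring:
  assumes m: "minimal_counterexample S" and D: "D \<inter> S \<noteq> {}" and closed: "\<And>x. x \<in> D \<Longrightarrow> nb S x \<subseteq> D"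
  obtains \<phi> where "good (S - D) {} \<phi>"
    "\<And>x. x \<in> S \<Longrightarrow> x \<notin> D \<Longrightarrow> nb S x \<inter> D = {}"
proof -
  have no: "nb S x \<inter> D = {}" if "x \<in> S" "x \<notin> D" for x
    using that closed nb_sym[of _ S x] by blast
  have "pentagon_free (S - D)"
  proof (rule ccontr)
    assume "\<not> ?thesis"
    then obtain b0 b1 b2 b3 b4 where b: "pentagon (S - D) b0 b1 b2 b3 b4"
      by (auto simp: pentagon_free_def)
    obtain x where "x \<in> {b0, b1, b2, b3, b4}" "nb S x \<inter> D \<noteq> {}"
      using pentagon_exit[OF m b] .
    then show False using no pentagon_in[OF b] by blast
  qed
  then show thesis using minimal_IH[OF m D] that no by blast
qed

text \<open>
  By \<open>deg2_pair_reducible\<close>, the neighbours of adjacent vertices \<open>x2, x3\<close> of degree 2 again have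
  degree 2. Following them three steps in each direction shows a cycle of length 3, 4 or 5, or a
  reducible path \<open>x1 x2 x3 x4\<close>. For length 3 and 4 the whole component is deleted and gets
  distinct colours; length 5 is excluded by hypothesis.
\<close>
lemma deg2_independent:
  assumes m: "minimal_counterexample S" and uS: "x2 \<in> S" and "x3 \<in> nb S x2"
    and "card (nb S x2) = 2" "card (nb S x3) = 2"
  shows False
proof -
  have next_vertex: "\<exists>w. nb S v = {u, w} \<and> w \<noteq> u \<and> card (nb S w) = 2 \<and> v \<in> nb S w \<and> w \<in> S \<and> w \<noteq> v"
    if uv: "u \<in> S" "v \<in> nb S u" "card (nb S u) = 2" "card (nb S v) = 2" for u v
  proof -
    have vS: "v \<in> S" and vu: "u \<in> nb S v" using uv nb_in nb_sym by blast+
    obtain w where w: "nb S v = {u, w}" "u \<noteq> w" using other_neighbour[OF uv(4) vu] .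
    obtain a where a: "nb S u = {v, a}" "v \<noteq> a" using other_neighbour[OF uv(3,2)] .
    have wS: "w \<in> S" using nb_in[of w S v] w by simp
    have "card (nb S w) \<noteq> 3"
      using deg2_pair_reducible[OF m uv(1) vS, of a w] a w by (auto simp: insert_commute)
    then have "card (nb S w) = 2"
      using minimal_counterexampleD(3)[OF m wS] minimal_degree_ge_2[OF m wS] by simp
    moreover have "v \<in> nb S w" using nb_sym[of w S v] w vS by simp
    moreover have "w \<noteq> v" using w nb_irrefl[of v S] by auto
    ultimately show ?thesis using w wS by blast
  qed
  have x3S: "x3 \<in> S" using nb_in[OF assms(3)] .
  have x23: "x2 \<in> nb S x3" using nb_sym[OF assms(3) uS] .
  obtain x4 where x4: "nb S x3 = {x2, x4}" "x4 \<noteq> x2" "card (nb S x4) = 2" "x3 \<in> nb S x4"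
    "x4 \<in> S" "x4 \<noteq> x3"
    using next_vertex[OF uS assms(3,4,5)] by blast
  obtain x1 where x1: "nb S x2 = {x3, x1}" "x1 \<noteq> x3" "card (nb S x1) = 2" "x2 \<in> nb S x1"
    "x1 \<in> S" "x1 \<noteq> x2"
    using next_vertex[OF x3S x23 assms(5,4)] by blast
  have x23': "x2 \<noteq> x3" using assms(3) nb_irrefl by metis
  obtain q where q: "nb S x4 = {x3, q}" "q \<noteq> x3" "card (nb S q) = 2" "x4 \<in> nb S q"
    "q \<in> S" "q \<noteq> x4"
    using next_vertex[OF x3S _ assms(5) x4(3)] x4(1) by blast
  obtain p where p: "nb S x1 = {x2, p}" "p \<noteq> x2" "card (nb S p) = 2" "x1 \<in> nb S p"
    "p \<in> S" "p \<noteq> x1"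
    using next_vertex[OF uS _ assms(4) x1(3)] x1(1) by blast
  have l: "large 4 (L x1)" "large 4 (L x2)" "large 4 (L x3)" "large 4 (L x4)"
    using minimal_large4[OF m] x1 x4 uS x3S assms by auto
  obtain y1 where y1: "y1 \<in> L x1" using large_pick3[OF l(1)] by blast
  obtain y2 where y2: "y2 \<in> L x2" "y2 \<noteq> y1" using large_pick3[OF l(2)] by blast
  obtain y3 where y3: "y3 \<in> L x3" "y3 \<noteq> y1" "y3 \<noteq> y2" using large_pick3[OF l(3)] by blast
  obtain y4 where y4: "y4 \<in> L x4" "y4 \<noteq> y1" "y4 \<noteq> y2" "y4 \<noteq> y3"
    using large_pick3[OF l(4)] by blast
  consider "x1 = x4" | "x1 \<noteq> x4" "p = x4" | "x1 \<noteq> x4" "p \<noteq> x4" "p = q"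
    | "x1 \<noteq> x4" "p \<noteq> x4" "p \<noteq> q" by blast
  then show False
  proof cases
    case 1
    let ?D = "{x1, x2, x3}"
    have n: "nb S x1 = {x2, x3}" using x1 x4 1 p q x23' by auto
    have n2: "nb S x3 = {x1, x2}" using x4 1 by auto
    obtain \<phi> where g: "good (S - ?D) {} \<phi>"
      and no: "\<And>x. x \<in> S \<Longrightarrow> x \<notin> ?D \<Longrightarrow> nb S x \<inter> ?D = {}"
      by (rule closed_set_colouring[OF m, of ?D]) (use n n2 x1 uS in auto)
    define \<psi> where "\<psi> = \<phi>(x1 := y1, x2 := y2, x3 := y3)"
    have \<psi>: "\<psi> x1 = y1" "\<psi> x2 = y2" "\<psi> x3 = y3" using x1 x23' by (auto simp: \<psi>_def)
    have "good S {} \<psi>"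
    proof (rule good_extend[OF g])
      fix x assume "x \<in> ?D"
      then show "diverse S \<psi> x" using n n2 x1(1) \<psi> y2 y3 by (auto intro: diverseI)
    qed (use no \<psi> n n2 x1 y1 y2 y3 in \<open>auto simp: \<psi>_def\<close>)
    then show False using minimal_counterexampleD(6)[OF m] by blast
  next
    case 2
    let ?D = "{x1, x2, x3, x4}"
    have "x1 \<in> nb S x4" using p 2 by simp
    then have qx: "q = x1" using q x1 by auto
    obtain \<phi> where g: "good (S - ?D) {} \<phi>"
      and no: "\<And>x. x \<in> S \<Longrightarrow> x \<notin> ?D \<Longrightarrow> nb S x \<inter> ?D = {}"
      by (rule closed_set_colouring[OF m, of ?D]) (use x1 x4 p q qx 2 uS in auto)
    define \<psi> where "\<psi> = \<phi>(x1 := y1, x2 := y2, x3 := y3, x4 := y4)"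
    have \<psi>: "\<psi> x1 = y1" "\<psi> x2 = y2" "\<psi> x3 = y3" "\<psi> x4 = y4"
      using x1 x4 2 x23' by (auto simp: \<psi>_def)
    have n: "nb S x1 = {x2, x4}" "nb S x2 = {x3, x1}" "nb S x3 = {x2, x4}" "nb S x4 = {x3, x1}"
      using p q qx 2 x1 x4 by auto
    have "good S {} \<psi>"
    proof (rule good_extend[OF g])
      fix x assume "x \<in> ?D"
      then show "diverse S \<psi> x" using n \<psi> y2 y3 y4 by (auto intro: diverseI)
    qed (use no \<psi> n y1 y2 y3 y4 in \<open>auto simp: \<psi>_def\<close>)
    then show False using minimal_counterexampleD(6)[OF m] by blast
  next
    case 3
    have "x4 \<in> nb S p" using q 3 by simp
    then have "nb S p = {x1, x4}"
      using other_neighbour[OF p(3,4)] 3 by (metis insertE singletonD)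
    moreover have "p \<noteq> x3" using 3 q by simp
    ultimately have "pentagon S x1 x2 x3 x4 p"
      using x1 x4 p q 3 x23' by (auto simp: pentagon_def)
    then show False using minimal_counterexampleD(5)[OF m] by (auto simp: pentagon_free_def)
  next
    case 4
    obtain p' where p': "nb S p = {x1, p'}" "x1 \<noteq> p'" using other_neighbour[OF p(3,4)] .
    obtain q' where q': "nb S q = {x4, q'}" "x4 \<noteq> q'" using other_neighbour[OF q(3,4)] .
    have px3: "p \<noteq> x3" using p(4) x4(1) x1(6) 4 by auto
    have qx2: "q \<noteq> x2" using q(4) x1(1) x4(6) 4 by auto
    have qx1: "q \<noteq> x1" using q(4) p(1) x4(2) 4 by auto
    have pb: "p \<in> nb S p'" "q \<in> nb S q'"
      using nb_sym[of p' S p] nb_sym[of q' S q] p' q' p(5) q(5) by auto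
    have p'n: "p' \<noteq> x2" "p' \<noteq> x3" "p' \<noteq> x4"
      using pb(1) x1(1) x4(1) q(1) px3 p 4 by auto
    have q'n: "q' \<noteq> x3" "q' \<noteq> x2" "q' \<noteq> x1"
      using pb(2) x1(1) x4(1) p(1) qx2 qx1 q 4 by auto
    have "nb (S - {x1, x2, x3, x4}) p = {p'}" "nb (S - {x1, x2, x3, x4}) q = {q'}"
      using p' q' p'n q'n by (auto simp: nb_Diff)
    then show False
      using path4_reducible[OF m refl, of x1 x2 x3 x4 p q p' q'] x1 x4 p q p' q' p'n q'n 4 x23'
        uS x3S px3 qx2 qx1 by (auto simp: insert_commute)
  qed
qed


section \<open>Vertices of degree 3\<close>

text \<open>A set meeting every edge of a 5-cycle contains three of its vertices.\<close>
lemma five_cycle_vertex_cover: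
  assumes d: "distinct [c0, c1, c2, c3, c4]"
    and M: "c0 \<in> M \<or> c1 \<in> M" "c1 \<in> M \<or> c2 \<in> M" "c2 \<in> M \<or> c3 \<in> M" "c3 \<in> M \<or> c4 \<in> M"
      "c4 \<in> M \<or> c0 \<in> M"
  shows "\<exists>X \<subseteq> {c0, c1, c2, c3, c4}. X \<subseteq> M \<and> card X = 3"
proof (cases "c0 \<in> M")
  case True
  obtain x where x: "x \<in> {c1, c2}" "x \<in> M" using M by blast
  obtain y where y: "y \<in> {c3, c4}" "y \<in> M" using M by blast
  show ?thesis
    by (rule exI[of _ "{c0, x, y}"]) (use True x y d in auto)
next
  case False
  obtain x where x: "x \<in> {c2, c3}" "x \<in> M" using M by blast
  show ?thesis
    by (rule exI[of _ "{c1, x, c4}"]) (use False x M d in auto)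
qed

text \<open>
  For a neighbour \<open>w\<close> of \<open>u\<close>, the vertex \<open>e\<close> is where the path from \<open>u\<close> through \<open>w\<close> first reaches
  degree 3: it is \<open>w\<close> itself or the second neighbour of \<open>w\<close>. When \<open>u\<close> and its neighbours of degree
  2 are deleted, only the ends \<open>e\<close> of the three spokes are adjacent to the deleted set, and \<open>u\<close> must
  avoid exactly their colours.
\<close>
definition spoke :: "'a set \<Rightarrow> 'a \<Rightarrow> 'a \<Rightarrow> 'a \<Rightarrow> bool" where
  "spoke S u w e \<longleftrightarrow> e \<in> S \<and> e \<noteq> u \<and> card (nb S e) = 3 \<and> (w = e \<or> nb S w = {u, e})"

lemma spoke_exists:
  assumes m: "minimal_counterexample S" and uS: "u \<in> S" and w: "w \<in> nb S u"
  obtains e where "spoke S u w e"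
proof (cases "card (nb S w) = 3")
  case True
  have "w \<in> S" "w \<noteq> u" using w nb_in nb_irrefl by blast+
  then show thesis using True that by (auto simp: spoke_def)
next
  case False
  have wS: "w \<in> S" and uw: "u \<in> nb S w" using nb_in[OF w] nb_sym[OF w uS] .
  have w2: "card (nb S w) = 2" using False minimal_counterexampleD(3)[OF m wS] minimal_degree_ge_2[OF m wS] by simp
  obtain e where e: "nb S w = {u, e}" "u \<noteq> e" using other_neighbour[OF w2 uw] .
  then have eS: "e \<in> S" "e \<in> nb S w" using nb_in[of e S w] by auto
  have "card (nb S e) = 3"
    using deg2_independent[OF m wS eS(2) w2] minimal_counterexampleD(3)[OF m eS(1)] minimal_degree_ge_2[OF m eS(1)] by force
  then show thesis using that[of e] e eS by (auto simp: spoke_def)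
qed

text \<open>
  No two adjacent vertices have degree 2, so on a 5-cycle left behind the ends \<open>e1, e2, e3\<close> form a
  vertex cover. Hence they are three distinct vertices of this 5-cycle, and it is the only one left
  behind. With \<open>e1\<close> exceptional, \<open>e2\<close> and \<open>e3\<close> still get different colours: they are not the two
  neighbours of \<open>e1\<close>, for then they would not cover the edge opposite to \<open>e1\<close>.
\<close>
lemma star_complement_colouring:
  assumes m: "minimal_counterexample S" and uS: "u \<in> S" and nu: "nb S u = {w1, w2, w3}"
    and k: "spoke S u w1 e1" "spoke S u w2 e2" "spoke S u w3 e3"
    and D: "D = {u} \<union> {w \<in> {w1, w2, w3}. card (nb S w) = 2}"
  obtains \<phi> where "good (S - D) {} \<phi>"
    | \<phi> where "good (S - D) {e1} \<phi>" "\<phi> e2 \<noteq> \<phi> e3"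
proof (cases "pentagon_free (S - D)")
  case True
  then show thesis using minimal_IH[OF m, of D] uS that(1) unfolding D by blast
next
  case False
  let ?M = "{e1, e2, e3}"
  have border: "x \<in> ?M" if x: "x \<in> S" "x \<notin> D" "nb S x \<inter> D \<noteq> {}" for x
  proof -
    obtain d where d: "d \<in> D" "x \<in> nb S d" using x nb_sym[of _ S x] by blast
    consider "d = u" | "d \<in> {w1, w2, w3}" "card (nb S d) = 2" using d(1) D by blast
    then show ?thesis
    proof cases
      case 1
      then have "x \<in> {w1, w2, w3}" using d nu by simp
      moreover have "card (nb S x) \<noteq> 2" using x(2) calculation D by blast
      moreover have "card (nb S w) = 2" if "spoke S u w e" "w \<noteq> e" for w e
        using that unfolding spoke_def by auto
      ultimately show ?thesis using k by blast
    next
      case 2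
      moreover have "nb S w = {u, e}" if "spoke S u w e" "card (nb S w) = 2" for w e
        using that unfolding spoke_def by auto
      ultimately have "nb S d \<subseteq> {u, e1, e2, e3}" using k by blast
      then show ?thesis using d x(2) D by blast
    qed
  qed
  from False obtain b0 b1 b2 b3 b4 where b: "pentagon (S - D) b0 b1 b2 b3 b4"
    by (auto simp: pentagon_free_def)
  have cover: "c \<in> ?M \<or> d \<in> ?M" if "c \<in> S - D" "d \<in> nb (S - D) c"
    "card (nb (S - D) c) = 2" "card (nb (S - D) d) = 2" for c d
  proof (rule ccontr)
    assume n: "\<not> ?thesis"
    have dS: "d \<in> S - D" using nb_in[OF that(2)] .
    have "nb S c \<inter> D = {}" "nb S d \<inter> D = {}" using border[of c] border[of d] that(1) dS n by auto
    then have "nb S c = nb (S - D) c" "nb S d = nb (S - D) d" by (auto simp: nb_Diff)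
    then show False using deg2_independent[OF m, of c d] that by auto
  qed
  have pc: "c0 \<in> ?M \<or> c1 \<in> ?M" if p: "pentagon (S - D) c0 c1 c2 c3 c4" for c0 c1 c2 c3 c4
  proof (rule cover)
    show "c0 \<in> S - D" using pentagon_in[OF p] by blast
    show "c1 \<in> nb (S - D) c0" using p by (simp add: pentagon_def)
  qed (use pentagon_card[OF p] in auto)
  note r = pentagon_rotate
  have "distinct [b0, b1, b2, b3, b4]" using b by (simp add: pentagon_def)
  then obtain X where X: "X \<subseteq> {b0, b1, b2, b3, b4}" "X \<subseteq> ?M" "card X = 3"
    using five_cycle_vertex_cover[OF _ pc[OF b] pc[OF r[OF b]] pc[OF r[OF r[OF b]]]
      pc[OF r[OF r[OF r[OF b]]]] pc[OF r[OF r[OF r[OF r[OF b]]]]]] by blast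
  have cM: "card ?M \<le> 3" by (simp add: card_insert_if)
  then have XM: "X = ?M" using X card_seteq[of ?M X] by simp
  then have e_in: "?M \<subseteq> {b0, b1, b2, b3, b4}" and e3: "card ?M = 3" using X by auto
  then have dist: "e2 \<noteq> e3" by (auto simp: card_insert_if split: if_splits)
  obtain d1 d2 d3 d4 where d: "pentagon (S - D) e1 d1 d2 d3 d4"
    "{e1, d1, d2, d3, d4} = {b0, b1, b2, b3, b4}"
    using pentagon_at[OF b, of e1] e_in by blast
  have ne: "{e2, e3} \<noteq> {d1, d4}"
  proof
    assume "{e2, e3} = {d1, d4}"
    moreover have "d2 \<in> ?M \<or> d3 \<in> ?M" using pc[OF r[OF r[OF d(1)]]] .
    ultimately show False using d(1) unfolding pentagon_def by auto
  qed
  have T: "x \<in> {e1, d1, d2, d3, d4}" if "x \<in> S" "x \<notin> D" "nb S x \<inter> D \<noteq> {}" for x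
    using border[OF that] e_in unfolding d(2) by blast
  have DS: "D \<inter> S \<noteq> {}" using uS D by blast
  show thesis
  proof (rule pentagon_split[OF m DS d(1) T])
    fix \<phi> assume \<phi>: "good (S - D) {e1} \<phi>" "\<And>x y. x \<in> {e1, d1, d2, d3, d4} \<Longrightarrow>
      y \<in> {e1, d1, d2, d3, d4} \<Longrightarrow> x \<noteq> y \<Longrightarrow> {x, y} \<noteq> {d1, d4} \<Longrightarrow> \<phi> x \<noteq> \<phi> y"
    show thesis
      by (rule that(2)[OF \<phi>(1) \<phi>(2)]) (use e_in d(2) dist ne in auto)
  qed
qed

text \<open>
  Adjacent vertices \<open>u\<close> and \<open>v\<close> are deleted. At most four vertices are adjacent to them, so no
  5-cycle of degree-3 vertices is left behind. Besides the edges, the only conditions are those at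
  \<open>u\<close> and at \<open>v\<close>. If \<open>a\<close> and \<open>b\<close> agree, then \<open>u\<close> has one constraint fewer and \<open>v\<close> one more,
  so \<open>v\<close> is coloured first; otherwise \<open>u\<close> is coloured first.
\<close>
lemma cubic_reducible:
  assumes m: "minimal_counterexample S" and uS: "u \<in> S" and cubic: "\<And>x. x \<in> S \<Longrightarrow> card (nb S x) = 3"
  shows False
proof -
  have "nb S u \<noteq> {}" using cubic[OF uS] by auto
  then obtain v where vu: "v \<in> nb S u" by blast
  have vS: "v \<in> S" and uv: "u \<in> nb S v" using nb_in[OF vu] nb_sym[OF vu uS] .
  obtain a b where nu: "nb S u = {v, a, b}" "v \<noteq> a" "v \<noteq> b" "a \<noteq> b"
    using other_neighbours[OF cubic[OF uS] vu] .
  obtain c d where nv: "nb S v = {u, c, d}" "u \<noteq> c" "u \<noteq> d" "c \<noteq> d"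
    using other_neighbours[OF cubic[OF vS] uv] .
  have o: "a \<noteq> u" "b \<noteq> u" "c \<noteq> v" "d \<noteq> v" "u \<noteq> v"
    using nb_irrefl[of u S] nb_irrefl[of v S] nu nv by auto
  let ?D = "{u, v}"
  have "pentagon_free (S - ?D)"
  proof (rule ccontr)
    assume "\<not> ?thesis"
    then obtain c0 c1 c2 c3 c4 where p: "pentagon (S - ?D) c0 c1 c2 c3 c4"
      by (auto simp: pentagon_free_def)
    have "x \<in> {a, b, c, d}" if x: "x \<in> {c0, c1, c2, c3, c4}" for x
    proof -
      have xS: "x \<in> S - ?D" using pentagon_in[OF p] x by blast
      have "nb (S - ?D) x \<noteq> nb S x" using pentagon_card[OF p x] cubic[of x] xS by auto
      then have "nb S x \<inter> ?D \<noteq> {}" by (auto simp: nb_Diff)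
      then have "x \<in> nb S u \<or> x \<in> nb S v" using xS nb_sym[of _ S x] by blast
      then show ?thesis using nu nv xS by auto
    qed
    then have "card {c0, c1, c2, c3, c4} \<le> card {a, b, c, d}" by (intro card_mono) auto
    moreover have "card {c0, c1, c2, c3, c4} = 5" using p by (simp add: pentagon_def)
    moreover have "card {a, b, c, d} \<le> 4" by (simp add: card_insert_if)
    ultimately show False by simp
  qed
  then obtain \<phi> where g: "good (S - ?D) {} \<phi>" using minimal_IH[OF m, of ?D] uS by blast
  have l: "large 4 (L u)" "large 4 (L v)" using minimal_large4[OF m] cubic uS vS by auto
  obtain \<alpha> \<beta> where c: "\<alpha> \<in> L u" "\<beta> \<in> L v" "\<alpha> \<noteq> \<phi> a" "\<alpha> \<noteq> \<phi> b" "\<beta> \<noteq> \<phi> c" "\<beta> \<noteq> \<phi> d" "\<alpha> \<noteq> \<beta>"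
    "\<phi> a = \<phi> b \<longrightarrow> \<beta> \<noteq> \<phi> a" "\<phi> c = \<phi> d \<longrightarrow> \<alpha> \<noteq> \<phi> c"
  proof (cases "\<phi> a = \<phi> b")
    case True
    obtain \<beta> where "\<beta> \<in> L v" "\<beta> \<noteq> \<phi> c" "\<beta> \<noteq> \<phi> d" "\<beta> \<noteq> \<phi> a" using large_pick3[OF l(2)] by blast
    moreover obtain \<alpha> where "\<alpha> \<in> L u" "\<alpha> \<noteq> \<phi> a" "\<alpha> \<noteq> \<phi> c" "\<alpha> \<noteq> \<beta>"
      using large_pick3[OF l(1)] by blast
    ultimately show thesis using True by (intro that[of \<alpha> \<beta>]) auto
  next
    case False
    obtain \<alpha> where "\<alpha> \<in> L u" "\<alpha> \<noteq> \<phi> a" "\<alpha> \<noteq> \<phi> b" "\<alpha> \<noteq> \<phi> c" using large_pick3[OF l(1)] by blast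
    moreover obtain \<beta> where "\<beta> \<in> L v" "\<beta> \<noteq> \<phi> c" "\<beta> \<noteq> \<phi> d" "\<beta> \<noteq> \<alpha>"
      using large_pick3[OF l(2)] by blast
    ultimately show thesis using False by (intro that[of \<alpha> \<beta>]) auto
  qed
  define \<psi> where "\<psi> = \<phi>(u := \<alpha>, v := \<beta>)"
  have \<psi>: "\<psi> u = \<alpha>" "\<psi> v = \<beta>" "\<psi> a = \<phi> a" "\<psi> b = \<phi> b" "\<psi> c = \<phi> c" "\<psi> d = \<phi> d"
    using o nu nv by (auto simp: \<psi>_def)
  have "good S {} \<psi>"
  proof (rule good_extend[OF g])
    fix x assume "x \<in> ?D"
    then consider "x = u" | "x = v" by blast
    then show "diverse S \<psi> x"
    proof cases
      case 1
      have "\<psi> a \<noteq> \<psi> b \<or> \<psi> v \<noteq> \<psi> a" using \<psi> c(8) by metis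
      then show ?thesis using 1 diverseI[of a S u b \<psi>] diverseI[of v S u a \<psi>] nu(1) by blast
    next
      case 2
      have "\<psi> c \<noteq> \<psi> d \<or> \<psi> u \<noteq> \<psi> c" using \<psi> c(9) by metis
      then show ?thesis using 2 diverseI[of c S v d \<psi>] diverseI[of u S v c \<psi>] nv(1) by blast
    qed
  next
    fix x assume x: "x \<in> S" "x \<notin> ?D" "x \<in> {} \<or> nb S x \<inter> ?D \<noteq> {} \<and> card (nb (S - ?D) x) < 2"
    have "u \<in> nb S x \<and> v \<in> nb S x"
    proof (rule ccontr)
      assume "\<not> ?thesis"
      then obtain y where "nb S x - ?D = nb S x - {y}" "y \<in> nb S x" using x(3) by blast
      then show False using x cubic[OF x(1)] by (simp add: nb_Diff)
    qed
    then show "diverse S \<psi> x" using diverseI[of u S x v \<psi>] \<psi> c by simp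
  next
    fix x assume "x \<in> ?D"
    then show "\<psi> x \<in> L x" using \<psi>(1,2) c(1,2) by blast
  next
    fix x y assume "x \<in> ?D" "y \<in> nb S x"
    then have "x = u \<and> (y = v \<or> y = a \<or> y = b) \<or> x = v \<and> (y = u \<or> y = c \<or> y = d)"
      using nu(1) nv(1) by auto
    then show "\<psi> x \<noteq> \<psi> y" using \<psi> c(3-7) by (elim disjE conjE) simp_all
  qed (simp add: \<psi>_def)
  then show False using minimal_counterexampleD(6)[OF m] by blast
qed

text \<open>
  Here \<open>u\<close> has at least two neighbours \<open>w1, w2\<close> of degree 2. Choosing the colour of \<open>w2\<close> different
  from that of \<open>w3\<close> settles \<open>u\<close>, which leaves \<open>w1\<close> free to settle \<open>e1\<close> by avoiding the colour of
  a further neighbour of \<open>e1\<close>. This covers both a 5-cycle with exceptional vertex \<open>e1\<close> and spokes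
  with the common end \<open>e1\<close>.
\<close>
lemma star_many_reducible:
  assumes m: "minimal_counterexample S" and uS: "u \<in> S" and nu: "nb S u = {w1, w2, w3}"
    and wd: "w1 \<noteq> w2" "w1 \<noteq> w3" "w2 \<noteq> w3"
    and k1: "nb S w1 = {u, e1}" and k2: "nb S w2 = {u, e2}" and k: "spoke S u w3 e3"
    and e: "e1 \<in> S" "e1 \<noteq> u" "card (nb S e1) = 3" "e2 \<in> S" "e2 \<noteq> u" "card (nb S e2) = 3"
  shows False
proof -
  define D where "D = {u} \<union> {w \<in> {w1, w2, w3}. card (nb S w) = 2}"
  have e3: "e3 \<in> S" "e3 \<noteq> u" "card (nb S e3) = 3" "w3 = e3 \<or> nb S w3 = {u, e3}"
    using k by (auto simp: spoke_def)
  have wS: "w1 \<in> S" "w2 \<in> S" "w3 \<in> S" using nb_subset[of S u] nu by auto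
  have c1: "card (nb S w1) = 2" "card (nb S w2) = 2" using k1 k2 e by auto
  have wu: "w1 \<noteq> u" "w2 \<noteq> u" "w3 \<noteq> u" using nb_irrefl[of u S] nu by auto
  have uD: "u \<in> D" "w1 \<in> D" "w2 \<in> D" "D \<subseteq> {u, w1, w2, w3}" using c1 by (auto simp: D_def)
  have cu: "card (nb S u) = 3" using nu wd by simp
  have eD: "e1 \<notin> D" "e2 \<notin> D" "e3 \<notin> D" using e e3 by (auto simp: D_def)
  have w3D: "w3 \<in> D \<longleftrightarrow> w3 \<noteq> e3"
  proof (cases "w3 = e3")
    case True
    then show ?thesis using eD(3) by simp
  next
    case False
    then have "card (nb S w3) = 2" using e3(2,4) by auto
    then show ?thesis using False by (simp add: D_def)
  qed
  have n3: "nb S w3 = {u, e3}" if "w3 \<in> D" using that w3D e3(4) by blast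
  have we: "w1 \<in> nb S e1" "w2 \<in> nb S e2" "w3 \<in> D \<Longrightarrow> w3 \<in> nb S e3"
    using nb_sym[of e1 S w1] nb_sym[of e2 S w2] nb_sym[of e3 S w3] k1 k2 n3 wS by auto
  have border: "x = e1 \<or> x = e2 \<or> x = e3" if x: "x \<in> S" "x \<notin> D" "nb S x \<inter> D \<noteq> {}" for x
  proof -
    obtain d where d: "d \<in> D" "x \<in> nb S d" using x nb_sym[of _ S x] by blast
    then show ?thesis using x(2) uD w3D nu k1 k2 n3 by auto
  qed
  have kk: "spoke S u w1 e1" "spoke S u w2 e2" using k1 k2 e by (auto simp: spoke_def)
  obtain \<phi> where g: "good (S - D) {e1} \<phi>"
  proof (rule star_complement_colouring[OF m uS nu kk k D_def])
    fix \<phi> assume "good (S - D) {} \<phi>"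
    then have "good (S - D) {e1} \<phi>" by (simp add: good_def)
    then show thesis by (rule that)
  qed (rule that)
  obtain c where c: "nb (S - D) e1 = {} \<or> (\<exists>x\<in>nb (S - D) e1. \<phi> x = c)" by blast
  have l: "large 4 (L u)" "large 4 (L w1)" "large 4 (L w2)"
    using minimal_large4[OF m] uS wS cu c1 by auto
  obtain a where a: "a \<in> L u" "a \<noteq> \<phi> e1" "a \<noteq> \<phi> e2" "a \<noteq> \<phi> e3" using large_pick3[OF l(1)] by blast
  obtain z3 where z3: "w3 \<in> D \<Longrightarrow> z3 \<in> L w3 \<and> z3 \<noteq> \<phi> e3" "w3 \<notin> D \<Longrightarrow> z3 = \<phi> w3" "z3 \<noteq> a"
  proof (cases "w3 \<in> D")
    case True
    then have l3: "large 4 (L w3)" using minimal_large4[OF m wS(3)] wu by (simp add: D_def)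
    obtain z where "z \<in> L w3" "z \<noteq> a" "z \<noteq> \<phi> e3" using large_pick3[OF l3] by blast
    then show thesis using True by (intro that[of z]) auto
  next
    case False
    then show thesis using that[of "\<phi> w3"] w3D a by auto
  qed
  obtain z2 where z2: "z2 \<in> L w2" "z2 \<noteq> a" "z2 \<noteq> \<phi> e2" "z2 \<noteq> z3"
    using large_pick3[OF l(3)] by blast
  obtain z1 where z1: "z1 \<in> L w1" "z1 \<noteq> a" "z1 \<noteq> \<phi> e1" "z1 \<noteq> c"
    using large_pick3[OF l(2)] by blast
  define \<psi> where "\<psi> = \<phi>(u := a, w1 := z1, w2 := z2, w3 := z3)"
  have \<psi>: "\<psi> u = a" "\<psi> w1 = z1" "\<psi> w2 = z2" "\<psi> w3 = z3"
    using wd wu by (auto simp: \<psi>_def)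
  have agree: "\<psi> x = \<phi> x" if "x \<notin> D" for x
    using that uD z3(2) by (auto simp: \<psi>_def)
  note \<psi>e = agree[OF eD(1)] agree[OF eD(2)] agree[OF eD(3)]
  have D_cases: "x = u \<or> x = w1 \<or> x = w2 \<or> x = w3 \<and> w3 \<in> D" if "x \<in> D" for x
    using that uD(4) by blast
  have "good S {} \<psi>"
  proof (rule good_extend[OF g])
    fix x assume "x \<in> D"
    then show "\<psi> x \<in> L x" using D_cases \<psi> a z1 z2 z3 by metis
  next
    fix x y assume "x \<in> D" "y \<in> nb S x"
    then show "\<psi> x \<noteq> \<psi> y" using D_cases[of x] \<psi> \<psi>e a z1 z2 z3 nu k1 k2 n3 by auto
  next
    fix x assume "x \<in> D"
    from D_cases[OF this] consider "x = u" | "x = w1" | "x = w2" | "x = w3" "w3 \<in> D" by blast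
    then show "diverse S \<psi> x"
    proof cases
      case 1
      then show ?thesis using diverseI[of w2 S u w3 \<psi>] nu \<psi> z2 by simp
    next
      case 2
      then show ?thesis using diverseI[of u S w1 e1 \<psi>] k1 \<psi> \<psi>e a by simp
    next
      case 3
      then show ?thesis using diverseI[of u S w2 e2 \<psi>] k2 \<psi> \<psi>e a by simp
    next
      case 4
      then show ?thesis using diverseI[of u S w3 e3 \<psi>] n3 \<psi> \<psi>e a by simp
    qed
  next
    fix x assume x: "x \<in> S" "x \<notin> D" "x \<in> {e1} \<or> nb S x \<inter> D \<noteq> {} \<and> card (nb (S - D) x) < 2"
    \<comment> \<open>The colour \<open>c\<close> settles \<open>e1\<close> unless all its neighbours are deleted; then two of them differ anyway.\<close>
    have at_e1: "diverse S \<psi> e1"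
    proof (cases "nb (S - D) e1 = {}")
      case True
      then have sub: "nb S e1 \<subseteq> {u, w1, w2, w3}" using uD(4) by (auto simp: nb_Diff)
      show ?thesis
      proof (cases "u \<in> nb S e1")
        case True
        then show ?thesis using diverseI[OF True we(1), of \<psi>] \<psi> z1 by simp
      next
        case False
        then have "nb S e1 \<subseteq> {w1, w2, w3}" using sub by blast
        moreover have "card {w1, w2, w3} = 3" using wd by simp
        ultimately have "nb S e1 = {w1, w2, w3}" using e(3) card_seteq[of "{w1, w2, w3}"] by simp
        then show ?thesis using diverseI[of w2 S e1 w3 \<psi>] \<psi> z2 by simp
      qed
    next
      case False
      then obtain y where y: "y \<in> nb (S - D) e1" "\<phi> y = c" using c by blast
      then have "\<psi> y = c" "y \<in> nb S e1" using agree by (auto simp: nb_def)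
      then show ?thesis using diverseI[OF we(1), of y \<psi>] z1 \<psi> by simp
    qed
    \<comment> \<open>A vertex of degree 3 with a single deleted neighbour is no obstacle.\<close>
    have one: False if "nb S x \<inter> D \<subseteq> {y}" "x \<noteq> e1" for y
    proof -
      have "card (nb S x) = 3" using x border e e3 that by blast
      moreover have "card (nb S x \<inter> D) \<le> 1" using that(1) card_mono[of "{y}"] by fastforce
      ultimately show False
        using x that(2) card_Int_Diff[OF minimal_counterexampleD(2)[OF m], of x D] by (auto simp: nb_Diff)
    qed
    have not_w1: "w1 \<notin> nb S x" if "x \<noteq> e1" using that nb_sym[of w1 S x] x uD(1) k1 by auto
    have not_w2: "w2 \<notin> nb S x" if "x \<noteq> e2" using that nb_sym[of w2 S x] x uD(1) k2 by auto
    show "diverse S \<psi> x"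
    proof (cases "x = e1")
      case True
      then show ?thesis using at_e1 by simp
    next
      case x1: False
      show ?thesis
      proof (cases "x = e2")
        case [simp]: True
        have "u \<in> nb S x \<or> w3 \<in> nb S x"
        proof (rule ccontr)
          assume "\<not> ?thesis"
          then have "nb S x \<inter> D \<subseteq> {w2}" using not_w1[OF x1] uD(4) by blast
          then show False using one x1 by blast
        qed
        then show ?thesis
          using diverseI[of w2 S x u \<psi>] diverseI[of w2 S x w3 \<psi>] we(2) \<psi> z2 by auto
      next
        case x2: False
        then have [simp]: "x = e3" using border x x1 by blast
        have "nb S x \<inter> D \<subseteq> {if w3 \<in> D then w3 else u}"
        proof (cases "w3 \<in> D")
          case True
          have "u \<notin> nb S x" using nb_sym[of u S x] x nu uD True by auto
          then show ?thesis using True not_w1[OF x1] not_w2[OF x2] uD(4) by auto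
        next
          case False
          then show ?thesis using not_w1[OF x1] not_w2[OF x2] uD(4) by auto
        qed
        then show ?thesis using one x1 by blast
      qed
    qed
  qed (use agree in auto)
  then show False using minimal_counterexampleD(6)[OF m] by blast
qed

text \<open>
  If \<open>w1\<close> is the only neighbour of \<open>u\<close> of degree 2, then its colour settles one of \<open>u\<close> and \<open>e1\<close>:
  the vertex \<open>u\<close> if no 5-cycle is left behind, since then \<open>e1\<close> keeps two neighbours of different
  colours or is adjacent to both \<open>u\<close> and \<open>w1\<close>, and \<open>e1\<close> if that is the exceptional vertex of a
  5-cycle, since then \<open>w2\<close> and \<open>w3\<close> differ.
\<close>
lemma star_one_reducible:
  assumes m: "minimal_counterexample S" and uS: "u \<in> S" and nu: "nb S u = {w1, w2, w3}"
    and wd: "w1 \<noteq> w2" "w1 \<noteq> w3" "w2 \<noteq> w3"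
    and k1: "nb S w1 = {u, e1}" and e: "e1 \<in> S" "e1 \<noteq> u" "card (nb S e1) = 3"
    and w3: "card (nb S w2) = 3" "card (nb S w3) = 3"
  shows False
proof -
  let ?D = "{u, w1}"
  have wS: "w1 \<in> S" "w2 \<in> S" "w3 \<in> S" using nb_subset[of S u] nu by auto
  have c1: "card (nb S w1) = 2" using k1 e by auto
  have wu: "w1 \<noteq> u" "w2 \<noteq> u" "w3 \<noteq> u" using nb_irrefl[of u S] nu by auto
  have cu: "card (nb S u) = 3" using nu wd by simp
  have e1w: "e1 \<noteq> w1" using c1 e by auto
  have we: "w1 \<in> nb S e1" using nb_sym[of e1 S w1] k1 wS by auto
  have border: "x = e1 \<or> x = w2 \<or> x = w3" if x: "x \<in> S" "x \<notin> ?D" "nb S x \<inter> ?D \<noteq> {}" for x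
  proof -
    obtain d where d: "d \<in> ?D" "x \<in> nb S d" using x nb_sym[of _ S x] by blast
    then show ?thesis using x(2) nu k1 by auto
  qed
  have kk: "spoke S u w1 e1" "spoke S u w2 w2" "spoke S u w3 w3"
    using k1 e w3 wu wS by (auto simp: spoke_def)
  have D: "?D = {u} \<union> {w \<in> {w1, w2, w3}. card (nb S w) = 2}" using c1 w3 by auto
  have l: "large 4 (L u)" "large 4 (L w1)" using minimal_large4[OF m] uS wS cu c1 by auto
  obtain F \<phi> where g: "good (S - ?D) F \<phi>" "F \<subseteq> {e1}" "F = {} \<or> \<phi> w2 \<noteq> \<phi> w3"
    by (rule star_complement_colouring[OF m uS nu kk D]) blast+
  obtain x where x: "x \<in> nb (S - ?D) e1"
  proof -
    have "nb (S - ?D) e1 \<noteq> {}"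
    proof
      assume "nb (S - ?D) e1 = {}"
      then have "card (nb S e1) \<le> card ?D" by (intro card_mono) (auto simp: nb_Diff)
      then show False using e(3) card_insert_le_m1[of 2 "{w1}" u] by simp
    qed
    then show thesis using that by blast
  qed
  obtain a where a: "a \<in> L u" "a \<noteq> \<phi> e1" "a \<noteq> \<phi> w2" "a \<noteq> \<phi> w3" using large_pick3[OF l(1)] by blast
  obtain z where z: "z \<in> L w1" "z \<noteq> a" "z \<noteq> \<phi> e1" "z \<noteq> (if F = {} then \<phi> w2 else \<phi> x)"
    using large_pick3[OF l(2)] by blast
  define \<psi> where "\<psi> = \<phi>(u := a, w1 := z)"
  have \<psi>: "\<psi> u = a" "\<psi> w1 = z" "\<psi> w2 = \<phi> w2" "\<psi> w3 = \<phi> w3" "\<psi> e1 = \<phi> e1" "\<psi> x = \<phi> x"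
    using wd wu e e1w x by (auto simp: \<psi>_def nb_def)
  have "good S {} \<psi>"
  proof (rule good_extend[OF g(1)])
    fix y assume "y \<in> ?D"
    then consider "y = u" | "y = w1" by blast
    then show "diverse S \<psi> y"
    proof cases
      case 1
      have "\<psi> w2 \<noteq> \<psi> w3 \<or> \<psi> w1 \<noteq> \<psi> w2" using z(4) g(3) \<psi> by (auto split: if_splits)
      then show ?thesis
        using 1 diverseI[of w2 S u w3 \<psi>] diverseI[of w1 S u w2 \<psi>] nu by blast
    next
      case 2
      then show ?thesis using diverseI[of u S w1 e1 \<psi>] k1 \<psi> a by simp
    qed
  next
    fix y assume y: "y \<in> S" "y \<notin> ?D" "y \<in> F \<or> nb S y \<inter> ?D \<noteq> {} \<and> card (nb (S - ?D) y) < 2"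
    show "diverse S \<psi> y"
    proof (cases "y \<in> F")
      case True
      then have "y = e1" "z \<noteq> \<phi> x" using g(2) z(4) by (auto split: if_splits)
      then show ?thesis using diverseI[OF we, of x \<psi>] x \<psi> by (auto simp: nb_Diff)
    next
      case False
      have c3: "card (nb S y) = 3" using border y e w3 False by blast
      have "u \<in> nb S y \<and> w1 \<in> nb S y"
      proof (rule ccontr)
        assume "\<not> ?thesis"
        then obtain v where "nb S y - ?D = nb S y - {v}" "v \<in> nb S y" using y(3) False by blast
        then show False using y c3 False by (simp add: nb_Diff)
      qed
      then show ?thesis using diverseI[of u S y w1 \<psi>] \<psi> z by simp
    qed
  qed (use \<psi> a z nu k1 in \<open>auto simp: \<psi>_def\<close>)
  then show False using minimal_counterexampleD(6)[OF m] by blast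
qed

lemma no_minimal_counterexample: "\<not> minimal_counterexample S"
proof
  assume m: "minimal_counterexample S"
  have "good {} {} (\<lambda>_. undefined)" by (simp add: good_def)
  then have "S \<noteq> {}" using minimal_counterexampleD(6)[OF m] by metis
  then obtain v where vS: "v \<in> S" by blast
  have deg: "card (nb S x) = 2 \<or> card (nb S x) = 3" if "x \<in> S" for x
    using minimal_degree_ge_2[OF m that] minimal_counterexampleD(3)[OF m that] by linarith
  show False
  proof (cases "\<exists>w\<in>S. card (nb S w) = 2")
    case False
    then show False using cubic_reducible[OF m vS] deg by blast
  next
    case True
    then obtain w1 where w1: "w1 \<in> S" "card (nb S w1) = 2" by blast
    then obtain u e1 where k1: "nb S w1 = {u, e1}" "u \<noteq> e1" unfolding card_2_iff by blast
    then have ue: "u \<in> S" "e1 \<in> S" "u \<in> nb S w1" "e1 \<in> nb S w1"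
      using nb_subset[of S w1] by auto
    have cu: "card (nb S u) = 3" and ce: "card (nb S e1) = 3"
      using deg2_independent[OF m w1(1) _ w1(2)] ue deg by blast+
    have "w1 \<in> nb S u" using nb_sym[OF ue(3) w1(1)] .
    then obtain w2 w3 where w: "nb S u = {w1, w2, w3}" "w1 \<noteq> w2" "w1 \<noteq> w3" "w2 \<noteq> w3"
      using other_neighbours[OF cu] by metis
    obtain e2 where e2: "spoke S u w2 e2" using spoke_exists[OF m ue(1), of w2] w by blast
    obtain e3 where e3: "spoke S u w3 e3" using spoke_exists[OF m ue(1), of w3] w by blast
    consider "w2 \<noteq> e2" | "w3 \<noteq> e3" | "w2 = e2" "w3 = e3" by blast
    then show False
    proof cases
      case 1
      then show False
        using star_many_reducible[OF m ue(1) w k1(1) _ e3 ue(2) _ ce] e2 k1 by (auto simp: spoke_def)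
    next
      case 2
      have "nb S u = {w1, w3, w2}" using w by auto
      then show False
        using star_many_reducible[OF m ue(1) _ _ _ _ k1(1) _ e2 ue(2) _ ce] e3 k1 w 2
        by (auto simp: spoke_def)
    next
      case 3
      then show False
        using star_one_reducible[OF m ue(1) w k1(1) ue(2) _ ce] e2 e3 k1 by (auto simp: spoke_def)
    qed
  qed
qed

section \<open>Induction\<close>

lemma admissible_subset: "admissible S \<Longrightarrow> T \<subseteq> S \<Longrightarrow> admissible T"
  unfolding admissible_def
proof (intro conjI ballI)
  fix v assume *: "finite S \<and> (\<forall>v\<in>S. card (nb S v) \<le> 3 \<and> large (list_size (card (nb S v))) (L v))"
    "T \<subseteq> S" "v \<in> T"
  have "finite (nb S v)" using * nb_subset finite_subset by metis
  moreover have "nb T v \<subseteq> nb S v" using *(2) by (auto simp: nb_def)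
  ultimately have le: "card (nb T v) \<le> card (nb S v)" by (rule card_mono)
  have v: "card (nb S v) \<le> 3" "large (list_size (card (nb S v))) (L v)" using * by auto
  show "card (nb T v) \<le> 3" using le v by simp
  show "large (list_size (card (nb T v))) (L v)" using list_size_mono[OF le] v(2) large_mono by blast
qed (auto intro: finite_subset)

theorem pentagon_free_colourable:
  assumes "admissible S" "pentagon_free S"
  shows "\<exists>\<phi>. good S {} \<phi>"
proof -
  have "finite S" using assms by (simp add: admissible_def)
  then show ?thesis using assms
  proof (induction S rule: finite_psubset_induct)
    case (psubset S)
    show ?case
    proof (rule ccontr)
      assume "\<not> ?case"
      moreover have "\<exists>\<phi>. good T {} \<phi>" if "T \<subset> S" "pentagon_free T" for T
        using psubset.IH[OF that(1) _ that(2)] admissible_subset[OF psubset.prems(1)] that by blast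
      ultimately have "minimal_counterexample S" using psubset.prems by (simp add: minimal_counterexample_def)
      then show False using no_minimal_counterexample by blast
    qed
  qed
qed

end

section \<open>Conflict-free colourings of connected subcubic graphs\<close>

text \<open>
  Two different colours occur on \<open>A\<close>, and at most one further element can repeat one of them; so the
  other one is unique.
\<close>
lemma ex_unique_colour:
  assumes A: "A \<noteq> {}" "finite A" "card A \<le> 3"
    and diverse: "2 \<le> card A \<Longrightarrow> \<exists>x\<in>A. \<exists>y\<in>A. f x \<noteq> f y"
  shows "\<exists>c. \<exists>!u. u \<in> A \<and> f u = c"
proof (cases "2 \<le> card A")
  case False
  moreover have "card A \<noteq> 0" using A by simp
  ultimately have "card A = 1" by linarith
  then obtain x where "A = {x}" by (auto simp: card_1_singleton_iff)
  then show ?thesis by auto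
next
  case True
  then obtain x y where xy: "x \<in> A" "y \<in> A" "f x \<noteq> f y" using diverse by blast
  have "x \<noteq> y" using xy(3) by blast
  then have "card (A - {x, y}) \<le> 1" using xy A by (simp add: card_Diff_subset)
  then have rest: "z = z'" if "z \<in> A - {x, y}" "z' \<in> A - {x, y}" for z z'
    using that A(2) by (metis One_nat_def card_le_Suc0_iff_eq finite_Diff)
  show ?thesis
  proof (cases "\<exists>z\<in>A - {x, y}. f z = f x")
    case True
    then have "u = y" if "u \<in> A" "f u = f y" for u
      using that rest xy(3) by (metis Diff_iff insertE singletonD)
    then show ?thesis using xy by blast
  next
    case False
    then have "u = x" if "u \<in> A" "f u = f x" for u
      using that xy(3) by (metis Diff_iff insertE singletonD)
    then show ?thesis using xy by blast
  qed
qed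

lemma connected_closed:
  assumes "pair_graph G" and con: "Digraph_Component.connected (with_proj G)"
    and c: "c \<in> X" "c \<in> pverts G" and closed: "\<And>x. x \<in> X \<Longrightarrow> neighborhood G x \<subseteq> X"
  shows "pverts G \<subseteq> X"
proof
  interpret pair_graph G by fact
  fix v assume v: "v \<in> pverts G"
  have "symmetric (with_proj G)" using pair_sym_arcs by simp
  then have "strongly_connected (with_proj G)"
    using symmetric_connected_imp_strongly_connected con by blast
  then have "c \<rightarrow>\<^sup>*\<^bsub>with_proj G\<^esub> v" using c(2) v by (auto simp: strongly_connected_def)
  then show "v \<in> X"
    by (induction rule: reachable_induct) (use c closed in \<open>auto simp: neighborhood_def\<close>)
qed

lemma cycle_graph_5:
  "parcs (cycle_graph 5) =
    {(0, 1), (1, 2), (2, 3), (3, 4), (4, 0), (1, 0), (2, 1), (3, 2), (4, 3), (0, 4)}"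
  (is "_ = ?A")
proof (intro equalityI subrelI)
  fix i j assume "(i, j) \<in> parcs (cycle_graph 5)"
  then have ij: "i < 5" "j < 5" "j = Suc i mod 5 \<or> i = Suc j mod 5"
    by (simp_all add: cycle_graph_def)
  have "i \<in> {0, 1, 2, 3, 4}" "j \<in> {0, 1, 2, 3, 4}" using ij(1,2) by auto
  then show "(i, j) \<in> ?A" using ij(3) by (elim insertE emptyE) simp_all
qed (auto simp: cycle_graph_def)

lemma iso_cycle_graph_5:
  assumes "pair_graph G" and d: "distinct [c0, c1, c2, c3, c4]"
    and V: "pverts G = {c0, c1, c2, c3, c4}"
    and n: "neighborhood G c0 = {c4, c1}" "neighborhood G c1 = {c0, c2}"
      "neighborhood G c2 = {c1, c3}" "neighborhood G c3 = {c2, c4}" "neighborhood G c4 = {c3, c0}"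
  shows "digraph_iso (with_proj G) (with_proj (cycle_graph 5))"
proof -
  interpret pair_graph G by fact
  define h :: "'a \<Rightarrow> nat" where "h = (\<lambda>_. 0)(c1 := 1, c2 := 2, c3 := 3, c4 := 4)"
  have h: "h c0 = 0" "h c1 = 1" "h c2 = 2" "h c3 = 3" "h c4 = 4"
    using d by (auto simp: h_def)
  have arcs: "parcs G = {(c0, c1), (c1, c2), (c2, c3), (c3, c4), (c4, c0),
    (c1, c0), (c2, c1), (c3, c2), (c4, c3), (c0, c4)}"
    (is "_ = ?A")
  proof (intro equalityI subrelI)
    have mem: "(x, y) \<in> parcs G \<longleftrightarrow> y \<in> neighborhood G x" for x y
      by (simp add: neighborhood_def)
    fix x y
    {
      assume xy: "(x, y) \<in> parcs G"
      then have "x \<in> {c0, c1, c2, c3, c4}" using in_arcsD1 V by blast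
      then show "(x, y) \<in> ?A" using xy unfolding mem by (elim insertE emptyE) (auto simp: n)
    next
      assume "(x, y) \<in> ?A"
      then show "(x, y) \<in> parcs G" unfolding mem by (auto simp: n)
    }
  qed
  have inj: "inj_on h (pverts G)" unfolding V by (auto simp: inj_on_def h)
  have inj2: "inj_on (map_prod h h) (parcs G)"
    using inj in_arcsD1 in_arcsD2 by (auto simp: inj_on_def)
  define f where "f = \<lparr>iso_verts = h, iso_arcs = map_prod h h, iso_head = snd, iso_tail = fst\<rparr>"
  have "wf_digraph (with_proj G)" by unfold_locales
  then have "pre_digraph.digraph_isomorphism (with_proj G) f"
    using inj inj2 by (simp add: pre_digraph.digraph_isomorphism_def f_def)
  moreover have "with_proj (cycle_graph 5) = app_iso f (with_proj G)"
  proof (rule pre_digraph.equality)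
    have "pverts (cycle_graph 5) = {0, 1, 2, 3, 4}" by (auto simp: cycle_graph_def)
    then show "verts (with_proj (cycle_graph 5)) = verts (app_iso f (with_proj G))"
      by (simp add: f_def V h)
    show "arcs (with_proj (cycle_graph 5)) = arcs (app_iso f (with_proj G))"
      by (simp add: f_def cycle_graph_5 arcs h)
  qed (simp_all add: f_def)
  ultimately show ?thesis unfolding digraph_iso_def by blast
qed

theorem theorem1p8:
  fixes G :: "'a pair_pre_digraph"
  assumes "pair_graph G"
    and "Digraph_Component.connected (with_proj G)"
    and "subcubic G"
    and "\<not> digraph_iso (with_proj G) (with_proj (cycle_graph 5))"
  shows "pcf_choosable TYPE('c) G (kappa G)"
  unfolding pcf_choosable_def
proof (intro allI impI)
  fix L :: "'a \<Rightarrow> 'c set"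
  assume lists: "\<forall>v\<in>pverts G. infinite (L v) \<or> kappa G v \<le> card (L v)"
  interpret G: pair_graph G by fact
  let ?V = "pverts G"
  interpret list_assignment "\<lambda>u v. (u, v) \<in> parcs G" L
    using G.pair_sym_arcs G.no_loops' by unfold_locales (auto simp: symmetric_def dest: symD)
  have nb: "nb ?V v = neighborhood G v" for v
    using G.in_arcsD2 by (auto simp: nb_def neighborhood_def)
  have deg: "card (nb ?V v) \<le> 3" if "v \<in> ?V" for v
  proof -
    have "vdegree G v \<le> max_degree G"
      unfolding max_degree_def using that G.pair_finite_verts by (intro Max_ge) auto
    then show ?thesis using assms(3) by (simp add: subcubic_def nb vdegree_def)
  qed
  have "list_size (card (nb ?V v)) = kappa G v" for v
    by (simp add: list_size_def kappa_def nb vdegree_def)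
  then have "admissible ?V"
    using deg lists G.pair_finite_verts by (auto simp: admissible_def large_def)
  moreover have "pentagon_free ?V"
  proof (rule ccontr)
    assume "\<not> ?thesis"
    then obtain c0 c1 c2 c3 c4 where p: "pentagon ?V c0 c1 c2 c3 c4"
      by (auto simp: pentagon_free_def)
    have "neighborhood G x \<subseteq> {c0, c1, c2, c3, c4}" if "x \<in> {c0, c1, c2, c3, c4}" for x
      using that p by (auto simp: pentagon_def nb)
    then have "?V \<subseteq> {c0, c1, c2, c3, c4}"
      using connected_closed[OF assms(1,2), of c0 "{c0, c1, c2, c3, c4}"] pentagon_in[OF p] by auto
    then have "?V = {c0, c1, c2, c3, c4}" using pentagon_in[OF p] by blast
    then show False
      using iso_cycle_graph_5[OF assms(1) _ _] assms(4) p unfolding pentagon_def nb by blast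
  qed
  ultimately obtain \<phi> where \<phi>: "good ?V {} \<phi>" using pentagon_free_colourable by blast
  have "list_coloring G L \<phi>"
    using goodD(1,2)[OF \<phi>] G.in_arcsD1 by (auto simp: list_coloring_def nb neighborhood_def)
  moreover have "conflict_free G \<phi>"
    unfolding conflict_free_def
  proof (intro ballI impI)
    fix v assume v: "v \<in> ?V" "neighborhood G v \<noteq> {}"
    have "finite (neighborhood G v)"
      using finite_subset[OF nb_subset G.pair_finite_verts, of v] by (simp add: nb)
    then show "\<exists>c. \<exists>!u. u \<in> neighborhood G v \<and> \<phi> u = c"
      using v(2) deg[OF v(1)] goodD(3)[OF \<phi> v(1)]
      by (intro ex_unique_colour) (auto simp: nb diverse_def)
  qed
  ultimately show "\<exists>\<phi>. list_coloring G L \<phi> \<and> conflict_free G \<phi>" by blast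
qed

end
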